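(* (i) For $\operatorname{Re}p>0$, $|\arg y|<\pi$, $y\ge0$, $|\arg x|<\pi$, $x\ge0$, $|\arg x+\arg y|<\pi$, $$ \exp\left(p(x+y)\right)\operatorname{erfc}\left(y^{1/2}p^{1/2}\right)\operatorname{erfc}\left(x^{1/2}p^{1/2}\right)=\frac1\pi\int_0^\infty e^{-pt}\,\frac{\sqrt x\sqrt{x+t}+\sqrt y\sqrt{y+t}}{(x+y+t)\sqrt{(x+t)(y+t)}}\,dt . $$ (ii) For $\operatorname{Re}a>0$, $a\ge0$, $\operatorname{Re}b>0$, $b\ge0$, $$ \operatorname{erfc}(a)\operatorname{erfc}(b)=\frac1\pi e^{-(a^2+b^2)}\int_0^\infty e^{-t}\,\frac{a\sqrt{t+a^2}+b\sqrt{t+b^2}}{(t+a^2+b^2)\sqrt{(t+a^2)(t+b^2)}}\,dt . $$ (iii) For $\operatorname{Re}b>0$, $b>0$, $$ \operatorname{erfc}(b)=\frac{b}{\pi}e^{-b^2}\int_0^\infty\frac{e^{-t}}{(t+b^2)\sqrt t}\,dt,\qquad \operatorname{erf}(b)=1-\frac{b}{\pi}e^{-b^2}\int_0^\infty\frac{e^{-t}}{(t+b^2)\sqrt t}\,dt . $$ (iv) For $\operatorname{Re}a>0$, $a>0$, $\operatorname{Re}b>0$, $b>0$, $$ \begin{aligned} 1-\operatorname{erf}(a)\operatorname{erf}(b)&=\frac{b}{\pi}e^{-b^2}\int_0^\infty e^{-t}\left\{\frac{1}{(t+b^2)\sqrt t}-\frac{e^{-a^2}}{(t+a^2+b^2)\sqrt{t+a^2}}\right\}dt\\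 &\quad+\frac{a}{\pi}e^{-a^2}\int_0^{b^2}\frac{e^{-t}}{(t+a^2)\sqrt t}\,dt . \end{aligned} $$ (v) In particular, taking $a=b$ in (iv) gives $$ 1-\operatorname{erf}(a)^2=\frac{2a}{\pi}e^{-a^2}\int_0^{a^2}\frac{e^{-t}}{(t+a^2)\sqrt t}\,dt, $$ and the substitution $t=a^2s^2$ then gives the previously known representation $$ 1-\operatorname{erf}(a)^2=\frac4\pi e^{-a^2}\int_0^1\frac{e^{-a^2s^2}}{s^2+1}\,ds . $$
   Context: $\operatorname{erf}(z)=\frac{2}{\sqrt\pi}\int_0^z e^{-s^2}ds$ is the error function and $\operatorname{erfc}(z)=1-\operatorname{erf}(z)$ is the complementary error function. Square roots are principal values.
   Formalization: Parts (i), (ii) exclude x=y=0 and a=b=0, where the left side is 1 and the right side 0; the variables may be complex, with |arg a+arg b|<π/2 required in (ii) and |arg a−arg b|<π/2 in (iv), both automatic for the stated real a, b. *)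

theory Defs
  imports "HOL-Complex_Analysis.Complex_Analysis"
begin

definition erf :: "complex \<Rightarrow> complex" where
  "erf z = 2 / of_real (sqrt pi) * contour_integral (linepath 0 z) (\<lambda>s. exp (- (s ^ 2)))"

definition erfc :: "complex \<Rightarrow> complex" where
  "erfc z = 1 - erf z"

text \<open>
  Principal square roots are \<^const>\<open>csqrt\<close>, principal arguments are \<^const>\<open>Arg\<close>; note that
  \<^prop>\<open>Arg 0 = 0\<close>, so that \<^prop>\<open>\<bar>Arg x\<bar> < pi\<close> holds for \<^prop>\<open>x = 0\<close>.
  Integrals over real ranges are Lebesgue integrals. An integral from \<open>0\<close> to a complex point is
  taken along the straight segment; \<^const>\<open>contour_integral\<close> of a \<^const>\<open>linepath\<close> is a gauge
  integral over the unit interval, which covers an integrable singularity at the starting point.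
\<close>

end

theory Submission
  imports Defs "HOL-Real_Asymp.Real_Asymp"
begin

text \<open>
  All identities are proved by replacing the arguments \<open>a\<close>, \<open>b\<close> by \<open>a * \<surd>p\<close>, \<open>b * \<surd>p\<close> and
  comparing both sides as holomorphic functions of \<open>p\<close> on \<open>Re p > 0\<close>: their \<open>p\<close>-derivatives agree
  because \<open>\<integral>\<^sub>0\<^sup>\<infinity> exp (- p * t) / \<surd>(a\<^sup>2 + t) dt\<close> is an elementary multiple of \<open>erfc (a * \<surd>p)\<close>,
  and their limits for \<open>p \<rightarrow> 0\<close> agree because the remaining algebraic integrals are arctangents.

  The integrand of (i) has an apparent pole at \<open>t = - (a\<^sup>2 + b\<^sup>2)\<close>. With \<open>X = \<surd>(a\<^sup>2 + t)\<close> and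
  \<open>Y = \<surd>(b\<^sup>2 + t)\<close> the identity
  \<open>(a * X + b * Y) * (X * Y + a * b) = (a\<^sup>2 + b\<^sup>2 + t) * (a * Y + b * X)\<close> turns it into the
  regular kernel \<open>(a * Y + b * X) / ((X * Y + a * b) * X * Y)\<close>.
\<close>

section \<open>Shifted square roots and integrals over the half line\<close>

text \<open>The parameter \<open>p\<close> enters because the half-line integrands carry the
  denominator \<open>t + a\<^sup>2 + b\<^sup>2\<close>: in front of the Laplace integral stands
  \<open>exp (- p * (a\<^sup>2 + b\<^sup>2))\<close>, so one \<open>p\<close>-derivative brings down
  exactly this factor and only shifted roots remain. For complex \<open>a\<close>, \<open>b\<close>
  the obstacle is branch cuts and zeros. Such questions are reduced to positivity of a real part:
  \<open>Re (a * b)\<close> for two factors \<open>erfc\<close>, \<open>Re (a * cnj b)\<close> for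
  two factors \<open>erf\<close>; shifting \<open>a\<^sup>2\<close> by \<open>t\<close> preserves
  both conditions. The transform of a single shifted root needs \<open>erfc\<close> to vanish along
  a complex curve; that decay is extracted from the formula for \<open>1 - (erf z)\<^sup>2\<close>,
  an integral over a compact interval where no such limit occurs. For positive real
  \<open>a\<close>, \<open>b\<close> everything is Gaussian mass in a quadrant:
  \<open>erfc a * erfc b\<close> belongs to a corner region, \<open>1 - erf a * erf b\<close> to the
  complement of a rectangle.\<close>

declare csqrt.simps [simp del]

text \<open>A value on the cut would be real, which for \<open>Re a > 0\<close> forces
  \<open>Im a = 0\<close> and then makes the value positive. Off the cut the principal root cannot
  be purely imaginary, since the square of an imaginary number is a nonpositive real.\<close>

lemma csqrt_add_pos:
  fixes a :: complex and t :: real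
  assumes "Re a > 0 \<or> a = 0" "t > 0 \<or> t = 0 \<and> a \<noteq> 0"
  shows "a\<^sup>2 + of_real t \<notin> \<real>\<^sub>\<le>\<^sub>0" "Re (csqrt (a\<^sup>2 + of_real t)) > 0"
proof -
  show *: "a\<^sup>2 + of_real t \<notin> \<real>\<^sub>\<le>\<^sub>0"
  proof
    assume "a\<^sup>2 + of_real t \<in> \<real>\<^sub>\<le>\<^sub>0"
    then have le: "Re a * Re a - Im a * Im a + t \<le> 0" and im: "Re a * Im a = 0"
      by (auto simp: complex_nonpos_Reals_iff power2_eq_square)
    from assms(1) show False
    proof
      assume "Re a > 0"
      with im have "Im a = 0" by simp
      moreover have "Re a * Re a > 0" using \<open>Re a > 0\<close> by simp
      ultimately show False using le assms(2) by auto
    qed (use le assms(2) in auto)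
  qed
  show "Re (csqrt (a\<^sup>2 + of_real t)) > 0"
  proof (rule ccontr)
    assume "\<not> Re (csqrt (a\<^sup>2 + of_real t)) > 0"
    then have "Re (csqrt (a\<^sup>2 + of_real t)) = 0"
      using csqrt_principal[of "a\<^sup>2 + of_real t"] by auto
    then have "(csqrt (a\<^sup>2 + of_real t))\<^sup>2 \<in> \<real>\<^sub>\<le>\<^sub>0"
      by (auto simp: complex_nonpos_Reals_iff power2_eq_square)
    then show False using * by simp
  qed
qed

text \<open>
  Passing from \<open>a\<close> to \<open>\<surd>(a\<^sup>2 + t)\<close> increases the real part and keeps the product of real and
  imaginary part, so the argument moves towards \<open>0\<close>.
\<close>

lemma Re_mult_csqrt_add:
  fixes a u :: complex and t :: real
  assumes "Re a > 0 \<or> a = 0" "t > 0 \<or> t = 0 \<and> a \<noteq> 0" "Re u > 0" "Re (u * a) \<ge> 0" "Re (u * a) > 0 \<or> t > 0"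
  shows "Re (u * csqrt (a\<^sup>2 + of_real t)) > 0"
proof -
  define y where "y = csqrt (a\<^sup>2 + of_real t)"
  have y: "Re y > 0" unfolding y_def using csqrt_add_pos assms by blast
  have sq: "y\<^sup>2 = a\<^sup>2 + of_real t" by (simp add: y_def)
  have re: "Re y * Re y - Im y * Im y = Re a * Re a - Im a * Im a + t"
    and im: "Re y * Im y = Re a * Im a"
    using arg_cong[OF sq, of Re] arg_cong[OF sq, of Im]
    by (simp_all add: Re_power2 Im_power2 flip: power2_eq_square)
  have a: "Re a \<ge> 0" "t \<ge> 0" using assms by auto
  \<comment> \<open>Eliminating \<open>Im y\<close> between the two equations gives \<open>((Re
    y)\<^sup>2 - (Re a)\<^sup>2) * ((Re y)\<^sup>2 + (Im a)\<^sup>2) = (Re y)\<^sup>2 * t\<close>,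
    which measures the growth of the real part.\<close>
  have key: "(Re y)\<^sup>2 \<ge> (Re a)\<^sup>2 + (if t > 0 then (Re y)\<^sup>2 * t / ((Re y)\<^sup>2 + (Im a)\<^sup>2) else 0)"
  proof -
    have "(Re y)\<^sup>2 * ((Re y)\<^sup>2 - (Im y)\<^sup>2) = (Re y)\<^sup>2 * ((Re a)\<^sup>2 - (Im a)\<^sup>2 + t)"
      using re by (simp add: power2_eq_square)
    moreover have "(Re y)\<^sup>2 * (Im y)\<^sup>2 = (Re a)\<^sup>2 * (Im a)\<^sup>2"
      using im by (metis power_mult_distrib)
    ultimately have "((Re y)\<^sup>2 - (Re a)\<^sup>2) * ((Re y)\<^sup>2 + (Im a)\<^sup>2) = (Re y)\<^sup>2 * t"
      by (simp add: algebra_simps)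
    moreover have "(Re y)\<^sup>2 + (Im a)\<^sup>2 > 0" using y by (simp add: add_pos_nonneg)
    then have "(Re y)\<^sup>2 + (Im a)\<^sup>2 \<noteq> 0" by linarith
    ultimately have "(Re y)\<^sup>2 - (Re a)\<^sup>2 = (Re y)\<^sup>2 * t / ((Re y)\<^sup>2 + (Im a)\<^sup>2)"
      by (rule eq_divide_imp[rotated])
    moreover have "t = 0" if "\<not> t > 0" using a that by simp
    ultimately show ?thesis by (cases "t > 0") auto
  qed
  have gt: "(Re y)\<^sup>2 > (Re a)\<^sup>2" if "t > 0"
  proof -
    have "(Re y)\<^sup>2 * t / ((Re y)\<^sup>2 + (Im a)\<^sup>2) > 0"
      using that y by (intro divide_pos_pos mult_pos_pos add_pos_nonneg) auto
    with key that show ?thesis by simp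
  qed
  have ge: "(Re y)\<^sup>2 \<ge> (Re a)\<^sup>2" using key gt by (cases "t > 0") auto
  \<comment> \<open>The factor \<open>Re y\<close> turns \<open>Im y\<close> into the invariant
    product \<open>Re y * Im y = Re a * Im a\<close>, leaving two nonnegative terms of which one is
    positive.\<close>
  have "Re (u * y) * Re y = Re u * (Re y)\<^sup>2 - Im u * (Re y * Im y)"
    by (simp add: algebra_simps power2_eq_square)
  also have "\<dots> = Re u * ((Re y)\<^sup>2 - (Re a)\<^sup>2) + Re a * Re (u * a)"
    unfolding im by (simp add: algebra_simps power2_eq_square)
  also have "\<dots> > 0"
  proof (cases "t > 0")
    case True
    then show ?thesis using gt assms a by (intro add_pos_nonneg mult_pos_pos mult_nonneg_nonneg) auto
  next
    case False
    then show ?thesis using ge assms a by (intro add_nonneg_pos mult_pos_pos mult_nonneg_nonneg) auto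
  qed
  finally show ?thesis using y unfolding y_def by (simp add: zero_less_mult_iff)
qed

text \<open>A positive \<open>t\<close> can be pulled out of the principal root, giving
  \<open>sqrt t * csqrt (c / t + 1)\<close>, and the second factor tends to 1.\<close>

lemma tendsto_csqrt_add_div_sqrt:
  fixes c :: complex
  shows "((\<lambda>t::real. csqrt (c + of_real t) / of_real (sqrt t)) \<longlongrightarrow> 1) at_top"
proof -
  have "((\<lambda>t::real. csqrt (c / of_real t + 1)) \<longlongrightarrow> csqrt (0 + 1)) at_top"
  proof (rule isCont_tendsto_compose[of _ csqrt])
    show "isCont csqrt (0 + 1)" by (rule continuous_at_csqrt) auto
    have "((\<lambda>t::real. c * of_real (inverse t)) \<longlongrightarrow> c * of_real 0) at_top"
      by (intro tendsto_intros tendsto_inverse_0_at_top filterlim_ident)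
    then show "((\<lambda>t::real. c / of_real t + 1) \<longlongrightarrow> 0 + 1) at_top"
      by (intro tendsto_intros) (simp add: divide_inverse)
  qed
  then have *: "((\<lambda>t::real. csqrt (c / of_real t + 1)) \<longlongrightarrow> 1) at_top" by simp
  have "eventually (\<lambda>t::real. csqrt (c / of_real t + 1) = csqrt (c + of_real t) / of_real (sqrt t)) at_top"
    using eventually_gt_at_top[of 0]
  proof eventually_elim
    case (elim t)
    have "csqrt (of_real t * (c / of_real t + 1)) = csqrt (of_real t) * csqrt (c / of_real t + 1)"
      using elim Arg_bounded[of "c / of_real t + 1"] by (intro csqrt_mult) auto
    moreover have "of_real t * (c / of_real t + 1) = c + of_real t" using elim by (simp add: field_simps)
    moreover have "csqrt (of_real t) = of_real (sqrt t)" using elim by (simp add: csqrt_of_real)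
    ultimately have "csqrt (c + of_real t) = of_real (sqrt t) * csqrt (c / of_real t + 1)"
      by metis
    moreover have "complex_of_real (sqrt t) \<noteq> 0" using elim by simp
    ultimately show ?case by (metis nonzero_mult_div_cancel_left)
  qed
  from Lim_transform_eventually[OF * this] show ?thesis .
qed

section \<open>Integrability and the fundamental theorem of calculus on the half line\<close>

lemma continuous_bounded_halfline:
  fixes g :: "real \<Rightarrow> 'a::real_normed_vector"
  assumes cont: "continuous_on {0<..} g" and l: "(g \<longlongrightarrow> l) (at_right 0)" and m: "(g \<longlongrightarrow> m) at_top"
  obtains C where "\<And>t. t > 0 \<Longrightarrow> norm (g t) \<le> C"
proof -
  have "eventually (\<lambda>t. norm (g t) < norm l + 1) (at_right 0)"
    by (rule order_tendstoD[OF tendsto_norm[OF l]]) simp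
  then obtain d where d: "d > 0" "\<And>t. 0 < t \<Longrightarrow> t < d \<Longrightarrow> norm (g t) < norm l + 1"
    unfolding eventually_at_right_field by auto
  have "eventually (\<lambda>t. norm (g t) < norm m + 1) at_top"
    by (rule order_tendstoD[OF tendsto_norm[OF m]]) simp
  then obtain N where N: "\<And>t. t \<ge> N \<Longrightarrow> norm (g t) < norm m + 1"
    unfolding eventually_at_top_linorder by auto
  have "compact (g ` {d..N})"
    using cont d(1) by (intro compact_continuous_image) (auto elim!: continuous_on_subset)
  then obtain B where B: "\<And>t. t \<in> {d..N} \<Longrightarrow> norm (g t) \<le> B"
    by (meson bounded_iff compact_imp_bounded imageI)
  show ?thesis
  proof
    fix t :: real assume "t > 0"
    then show "norm (g t) \<le> max (max (norm l + 1) (norm m + 1)) B"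
      using d(2)[of t] N[of t] B[of t] by (cases "t < d"; cases "t \<ge> N") (auto simp: le_max_iff_disj)
  qed
qed

text \<open>The weight behaves like \<open>t powr (1/2)\<close> at 0 and like
  \<open>t powr (3/2)\<close> at infinity, so finite limits of the weighted function give an
  integrable singularity and integrable decay.\<close>

lemma absolutely_integrable_halfline:
  fixes f :: "real \<Rightarrow> complex"
  assumes cont: "continuous_on {0<..} f"
    and l: "((\<lambda>t. of_real (sqrt t * (1 + t)) * f t) \<longlongrightarrow> l) (at_right 0)"
    and m: "((\<lambda>t. of_real (sqrt t * (1 + t)) * f t) \<longlongrightarrow> m) at_top"
  shows "f absolutely_integrable_on {0..}"
proof -
  have "continuous_on {0<..} (\<lambda>t. of_real (sqrt t * (1 + t)) * f t)"
    by (intro continuous_intros cont)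
  then obtain C where C: "\<And>t. t > 0 \<Longrightarrow> norm (of_real (sqrt t * (1 + t)) * f t) \<le> C"
    using continuous_bounded_halfline[OF _ l m] by metis
  have "C \<ge> 0" using C[of 1] norm_ge_zero order_trans zero_less_one by blast
  define G where "G t = (if t \<le> 1 then C * t powr (-(1/2)) else C * t powr (-(3/2)))" for t :: real
  have "(\<lambda>t. C * t powr (-(1/2))) integrable_on {0..1}"
    by (intro integrable_on_mult_right integrable_on_powr_from_0) auto
  then have G1: "G integrable_on {0..1}"
    by (rule integrable_eq) (auto simp: G_def)
  have "(\<lambda>t. t powr (-(3/2))) integrable_on {1::real..}"
    using has_integral_integrable[OF has_integral_powr_to_inf[of "-(3/2)" 1]] by simp
  then have "(\<lambda>t. C * t powr (-(3/2))) integrable_on {1..}"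
    by (rule integrable_on_mult_right)
  then have G2: "G integrable_on {1..}"
    by (rule integrable_spike[where S = "{}"]) (auto simp: G_def)
  have G: "G integrable_on {0..}"
  proof -
    have "G integrable_on ({0..1} \<union> {1..})"
    proof (rule integrable_Un[OF _ G1 G2])
      have "{0..1} \<inter> {1..} = {1::real}" by auto
      then show "negligible ({0..1} \<inter> {1..} :: real set)" by simp
    qed
    moreover have "{0..1} \<union> {1..} = {0::real..}" by auto
    ultimately show ?thesis by simp
  qed
  have G': "G integrable_on {0<..}"
    by (rule integrable_spike_set[OF G]; rule negligible_subset[of "{0}"]) auto
  have "f absolutely_integrable_on {0<..}"
  proof (rule measurable_bounded_by_integrable_imp_absolutely_integrable[OF _ _ G'])
    show "f \<in> borel_measurable (lebesgue_on {0<..})"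
      by (intro continuous_imp_measurable_on_sets_lebesgue cont) auto
    fix t :: real assume "t \<in> {0<..}"
    then have t: "t > 0" by simp
    have "norm (of_real (sqrt t * (1 + t)) * f t) = norm (f t) * (sqrt t * (1 + t))"
      unfolding norm_mult norm_of_real using t by (simp add: abs_mult)
    with C[OF t] have "norm (f t) * (sqrt t * (1 + t)) \<le> C" by metis
    moreover have "sqrt t * (1 + t) > 0" using t by simp
    ultimately have le: "norm (f t) \<le> C / (sqrt t * (1 + t))"
      by (intro mult_imp_le_div_pos)
    show "norm (f t) \<le> G t"
    proof (cases "t \<le> 1")
      case True
      have "C / (sqrt t * (1 + t)) \<le> C / (sqrt t * 1)"
        using t \<open>C \<ge> 0\<close> by (intro divide_left_mono mult_left_mono) auto
      also have "\<dots> = G t"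
      proof -
        have "t powr (-(1/2)) = 1 / sqrt t"
          unfolding powr_minus_divide using t by (simp add: powr_half_sqrt)
        then show ?thesis using True unfolding G_def by simp
      qed
      finally show ?thesis using le by linarith
    next
      case False
      have "C / (sqrt t * (1 + t)) \<le> C / (sqrt t * t)"
        using t \<open>C \<ge> 0\<close> by (intro divide_left_mono mult_left_mono) auto
      also have "\<dots> = G t"
      proof -
        have "t powr (3/2) = t powr (1/2) * t powr 1" unfolding powr_add[symmetric] by simp
        then have "t powr (-(3/2)) = 1 / (sqrt t * t)"
          unfolding powr_minus_divide using t by (simp add: powr_half_sqrt)
        then show ?thesis using False unfolding G_def by simp
      qed
      finally show ?thesis using le by linarith
    qed
  qed auto
  then show ?thesis
    by (rule absolutely_integrable_spike_set; intro negligible_subset[OF negligible_sing[of 0]]) auto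
qed

text \<open>The half line is exhausted by the intervals from \<open>1 / (k + 1)\<close> to
  \<open>k + 1\<close>, and absolute integrability supplies the dominating function. Only limits of
  the primitive are used at the ends, so \<open>f\<close> may be singular at 0.\<close>

lemma has_integral_FTC_halfline:
  fixes f F :: "real \<Rightarrow> complex"
  assumes int: "f absolutely_integrable_on {0..}"
    and F: "\<And>t. t > 0 \<Longrightarrow> (F has_vector_derivative f t) (at t)"
    and A: "(F \<longlongrightarrow> A) (at_right 0)" and B: "(F \<longlongrightarrow> B) at_top"
  shows "(f has_integral (B - A)) {0..}"
proof -
  define S where "S k = {inverse (real (Suc k))..real (Suc k)}" for k
  \<comment> \<open>The point 0 belongs to no truncation interval, so the pointwise limit there is 0
    and not \<open>f 0\<close>.\<close>
  define g where "g t = (if t = 0 then 0 else f t)" for t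
  have le: "inverse (real (Suc k)) \<le> real (Suc k)" for k
    by (metis inverse_le_1_iff le_numeral_extra(4) of_nat_Suc of_nat_0_le_iff le_add_same_cancel1 order_trans)
  have "(g has_integral (B - A)) {0..}"
  proof (rule has_integral_dominated_convergence)
    fix k
    have "(f has_integral F (real (Suc k)) - F (inverse (real (Suc k)))) (S k)"
      unfolding S_def
    proof (rule fundamental_theorem_of_calculus[OF le])
      fix x assume "x \<in> {inverse (real (Suc k))..real (Suc k)}"
      moreover have "inverse (real (Suc k)) > 0" by simp
      ultimately have "x > 0" by (meson atLeastAtMost_iff less_le_trans)
      then show "(F has_vector_derivative f x) (at x within {inverse (real (Suc k))..real (Suc k)})"
        using F has_vector_derivative_at_within by blast
    qed
    moreover have "S k \<subseteq> {0..}" by (auto simp: S_def intro: order_trans[rotated])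
    ultimately show "((\<lambda>t. if t \<in> S k then f t else 0) has_integral
        F (real (Suc k)) - F (inverse (real (Suc k)))) {0..}"
      by (simp add: has_integral_restrict)
  next
    show "(\<lambda>t. norm (f t)) integrable_on {0..}"
      using int by (simp add: absolutely_integrable_on_def)
    show "\<forall>t\<in>{0..}. norm (if t \<in> S k then f t else 0) \<le> norm (f t)" for k by auto
    show "\<forall>t\<in>{0..}. (\<lambda>k. if t \<in> S k then f t else 0) \<longlonglongrightarrow> g t"
    proof
      fix t :: real assume "t \<in> {0..}"
      show "(\<lambda>k. if t \<in> S k then f t else 0) \<longlonglongrightarrow> g t"
      proof (cases "t = 0")
        case True
        then have "t \<notin> S k" for k by (auto simp: S_def)
        then show ?thesis by (simp add: g_def True)
      next
        case False
        with \<open>t \<in> {0..}\<close> have t: "t > 0" by simp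
        have "eventually (\<lambda>k. inverse (real (Suc k)) < t) sequentially"
          using order_tendstoD(2)[OF LIMSEQ_inverse_real_of_nat t] .
        moreover have "eventually (\<lambda>k. real (Suc k) > t) sequentially"
          using filterlim_compose[OF filterlim_real_sequentially filterlim_Suc]
          by (simp add: filterlim_at_top_dense)
        ultimately have "eventually (\<lambda>k. (if t \<in> S k then f t else 0) = g t) sequentially"
          by eventually_elim (use False in \<open>auto simp: S_def g_def\<close>)
        then show ?thesis by (rule tendsto_eventually)
      qed
    qed
    have "filterlim (\<lambda>k. inverse (real (Suc k))) (at_right 0) sequentially"
      proof -
      have "inverse (real (Suc k)) \<noteq> 0" "inverse (real (Suc k)) > 0" for k by simp_all
      then show ?thesis using LIMSEQ_inverse_real_of_nat unfolding filterlim_at by auto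
    qed
    moreover have "filterlim (\<lambda>k. real (Suc k)) at_top sequentially"
      by (rule filterlim_compose[OF filterlim_real_sequentially filterlim_Suc])
    ultimately show "(\<lambda>k. F (real (Suc k)) - F (inverse (real (Suc k)))) \<longlonglongrightarrow> B - A"
      by (intro tendsto_diff filterlim_compose[OF A] filterlim_compose[OF B])
  qed
  then show ?thesis
    by (rule has_integral_spike[OF negligible_sing[of 0], rotated]) (auto simp: g_def)
qed

section \<open>Laplace transforms\<close>

lemma convex_half_plane: "convex {p. Re p > 0}"
  by (rule convex_halfspace_Re_gt)

text \<open>A vanishing derivative on the convex half-plane makes the difference constant, and a
  constant can be read off along the positive reals alone.\<close>

lemma complex_eq_on_half_plane:
  fixes f g :: "complex \<Rightarrow> complex"
  assumes f: "\<And>p. Re p > 0 \<Longrightarrow> (f has_field_derivative D p) (at p)"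
    and g: "\<And>p. Re p > 0 \<Longrightarrow> (g has_field_derivative D p) (at p)"
    and fl: "((\<lambda>r. f (of_real r)) \<longlongrightarrow> l) (at_right 0)"
    and gl: "((\<lambda>r. g (of_real r)) \<longlongrightarrow> l) (at_right 0)"
    and "Re p > 0"
  shows "f p = g p"
proof -
  have "((\<lambda>p. f p - g p) has_field_derivative 0) (at q within {p. Re p > 0})" if "q \<in> {p. Re p > 0}" for q
    using DERIV_diff[OF f g] that by (auto intro: has_field_derivative_at_within)
  then obtain c where c: "\<forall>q\<in>{p. Re p > 0}. f q - g q = c"
    using has_field_derivative_zero_constant[OF convex_half_plane] by blast
  have "((\<lambda>r. f (of_real r) - g (of_real r)) \<longlongrightarrow> l - l) (at_right 0)"
    by (intro tendsto_diff fl gl)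
  moreover have "eventually (\<lambda>r. f (of_real r) - g (of_real r) = c) (at_right 0)"
    using eventually_at_right_less by eventually_elim (use c in auto)
  ultimately have "((\<lambda>r::real. c) \<longlongrightarrow> l - l) (at_right 0)"
    by (rule Lim_transform_eventually)
  then have "c = 0" by (simp add: tendsto_const_iff)
  with c \<open>Re p > 0\<close> show ?thesis by auto
qed

lemma mult_exp_minus_le:
  fixes r t :: real
  assumes "r > 0" "t \<ge> 0"
  shows "t * exp (- r * t) \<le> 1 / r"
proof -
  have "r * t \<le> exp (r * t)" using exp_ge_add_one_self[of "r * t"] by linarith
  then show ?thesis using assms by (simp add: exp_minus field_simps)
qed

lemma absolutely_integrable_bounded_mult:
  fixes h g :: "real \<Rightarrow> complex"
  assumes h: "h absolutely_integrable_on {0..}" and g: "continuous_on {0..} g"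
    and B: "\<And>t. t \<ge> 0 \<Longrightarrow> norm (g t) \<le> B"
  shows "(\<lambda>t. g t * h t) absolutely_integrable_on {0..}"
proof (rule absolutely_integrable_bounded_measurable_product[where h = "(*)" and f = g and g = h])
  show "g \<in> borel_measurable (lebesgue_on {0..})"
    by (intro continuous_imp_measurable_on_sets_lebesgue g) auto
  show "bounded (g ` {0..})" unfolding bounded_iff using B by (intro exI[of _ B]) auto
  show "bilinear ((*) :: complex \<Rightarrow> _)"
    by (simp add: bilinear_conv_bounded_bilinear bounded_bilinear_mult)
qed (use h in auto)

lemma laplace_absolutely_integrable:
  fixes h :: "real \<Rightarrow> complex"
  assumes h: "h absolutely_integrable_on {0..}" and p: "Re p \<ge> 0"
  shows "(\<lambda>t. exp (- p * of_real t) * h t) absolutely_integrable_on {0..}"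
  by (rule absolutely_integrable_bounded_mult[OF h, where B = 1])
     (use p in \<open>auto intro!: continuous_intros\<close>)

lemma laplace_mult_absolutely_integrable:
  fixes h :: "real \<Rightarrow> complex"
  assumes h: "h absolutely_integrable_on {0..}" and p: "Re p > 0"
  shows "(\<lambda>t. of_real t * exp (- p * of_real t) * h t) absolutely_integrable_on {0..}"
  by (rule absolutely_integrable_bounded_mult[OF h, where B = "1 / Re p"])
     (use p mult_exp_minus_le[of "Re p"] in \<open>auto intro!: continuous_intros simp: norm_mult\<close>)

text \<open>Mean value inequality in the exponent: on the convex half-plane of real part at least
  \<open>r\<close> the derivative has norm at most \<open>t * exp (- r * t)\<close>.\<close>

lemma norm_exp_diff_le:
  fixes p q :: complex and r t :: real
  assumes "Re p \<ge> r" "Re q \<ge> r" "t \<ge> 0"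
  shows "norm (exp (- p * of_real t) - exp (- q * of_real t)) \<le> t * exp (- r * t) * norm (p - q)"
proof (rule field_differentiable_bound[where S = "{p. Re p \<ge> r}"])
  show "convex {p. Re p \<ge> r}" by (rule convex_halfspace_Re_ge)
  show "((\<lambda>p. exp (- p * of_real t)) has_field_derivative - of_real t * exp (- z * of_real t))
      (at z within {p. Re p \<ge> r})" for z
    by (auto intro!: derivative_eq_intros)
  show "norm (- of_real t * exp (- z * of_real t)) \<le> t * exp (- r * t)" if "z \<in> {p. Re p \<ge> r}" for z
    using that assms by (auto simp: norm_mult intro!: mult_left_mono mult_right_mono)
qed (use assms in auto)

lemma laplace_has_field_derivative:
  fixes h :: "real \<Rightarrow> complex"
  assumes h: "h absolutely_integrable_on {0..}" and p: "Re p > 0"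
  shows "((\<lambda>p. integral {0..} (\<lambda>t. exp (- p * of_real t) * h t)) has_field_derivative
    - integral {0..} (\<lambda>t. of_real t * exp (- p * of_real t) * h t)) (at p)"
proof -
  \<comment> \<open>Half of \<open>Re p\<close> leaves an open half-plane around \<open>p\<close> on
    which all difference quotients are dominated by \<open>norm (h t) / r\<close>.\<close>
  define r where "r = Re p / 2"
  have r: "r > 0" "Re p > r" using p by (auto simp: r_def)
  define H where "H = {q. Re q > r}"
  have H: "open H" "p \<in> H" using r by (simp_all add: H_def open_halfspace_Re_gt)
  define L where "L = (\<lambda>p. integral {0..} (\<lambda>t. exp (- p * of_real t) * h t))"
  have int: "(\<lambda>t. exp (- q * of_real t) * h t) integrable_on {0..}" if "q \<in> H" for q
    using laplace_absolutely_integrable[OF h, of q] that r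
    by (auto simp: H_def absolutely_integrable_on_def)
  have "((\<lambda>q. (L q - L p) / (q - p)) \<longlongrightarrow> integral {0..} (\<lambda>t. - (of_real t * exp (- p * of_real t) * h t))) (at p within H)"
    unfolding tendsto_at_iff_sequentially comp_def
  proof (intro allI impI)
    fix X assume X: "\<forall>i. X i \<in> H - {p}" "X \<longlonglongrightarrow> p"
    define f where "f k t = (exp (- X k * of_real t) * h t - exp (- p * of_real t) * h t) / (X k - p)" for k t
    have fint: "f k integrable_on {0..}" for k
      unfolding f_def using X(1) H by (intro integrable_on_divide integrable_diff int) auto
    have "(L (X k) - L p) / (X k - p) = integral {0..} (f k)" for k
      unfolding f_def L_def using integral_diff[OF int int, of "X k" p] X(1) H by simp
    moreover have "(\<lambda>k. integral {0..} (f k)) \<longlonglongrightarrow> integral {0..} (\<lambda>t. - (of_real t * exp (- p * of_real t) * h t))"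
    proof (rule dominated_convergence(2)[OF fint])
      show "(\<lambda>t. 1 / r * norm (h t)) integrable_on {0..}"
        using h by (intro integrable_on_mult_right) (simp add: absolutely_integrable_on_def)
      fix k and t :: real assume "t \<in> {0..}"
      then have t: "t \<ge> 0" by simp
      have "norm (exp (- X k * of_real t) - exp (- p * of_real t)) \<le> t * exp (- r * t) * norm (X k - p)"
        using X(1) r t by (intro norm_exp_diff_le) (auto simp: H_def less_imp_le)
      also have "\<dots> \<le> 1 / r * norm (X k - p)"
        by (intro mult_right_mono mult_exp_minus_le r t) auto
      finally have "norm (exp (- X k * of_real t) - exp (- p * of_real t)) / norm (X k - p) \<le> 1 / r"
        using X(1) by (simp add: pos_divide_le_eq)
      then have "norm (exp (- X k * of_real t) - exp (- p * of_real t)) / norm (X k - p) * norm (h t) \<le> 1 / r * norm (h t)"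
        by (intro mult_right_mono) auto
      moreover have "norm (f k t) = norm (exp (- X k * of_real t) - exp (- p * of_real t)) / norm (X k - p) * norm (h t)"
        unfolding f_def by (simp add: norm_divide norm_mult flip: left_diff_distrib)
      ultimately show "norm (f k t) \<le> 1 / r * norm (h t)" by simp
    next
      fix t :: real
      have "((\<lambda>q. exp (- q * of_real t) * h t) has_field_derivative - (of_real t * exp (- p * of_real t) * h t)) (at p within H)"
        by (auto intro!: derivative_eq_intros)
      moreover have "filterlim X (at p within H) sequentially"
        unfolding filterlim_at using X by (intro conjI always_eventually) auto
      ultimately show "(\<lambda>k. f k t) \<longlonglongrightarrow> - (of_real t * exp (- p * of_real t) * h t)"
        unfolding has_field_derivative_iff f_def by (rule filterlim_compose)
    qed
    ultimately show "(\<lambda>k. (L (X k) - L p) / (X k - p)) \<longlonglongrightarrow> integral {0..} (\<lambda>t. - (of_real t * exp (- p * of_real t) * h t))"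
      by simp
  qed
  then have "(L has_field_derivative integral {0..} (\<lambda>t. - (of_real t * exp (- p * of_real t) * h t))) (at p within H)"
    by (simp add: has_field_derivative_iff)
  then show ?thesis by (simp add: at_within_open[OF H(2,1)] L_def)
qed

text \<open>The factor \<open>exp (- p * c)\<close> turns multiplication by \<open>t\<close> into
  multiplication by \<open>t + c\<close>; with \<open>c = a\<^sup>2 + b\<^sup>2\<close> this is the
  denominator that has to be cancelled later.\<close>

lemma shifted_laplace_has_field_derivative:
  fixes h :: "real \<Rightarrow> complex"
  assumes h: "h absolutely_integrable_on {0..}" and p: "Re p > 0"
  shows "((\<lambda>p. exp (- p * c) * integral {0..} (\<lambda>t. exp (- p * of_real t) * h t)) has_field_derivative
    - exp (- p * c) * integral {0..} (\<lambda>t. exp (- p * of_real t) * ((of_real t + c) * h t))) (at p)"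
proof -
  have i1: "(\<lambda>t. exp (- p * of_real t) * h t) integrable_on {0..}"
    using laplace_absolutely_integrable[OF h, of p] p by (simp add: absolutely_integrable_on_def)
  have i2: "(\<lambda>t. of_real t * exp (- p * of_real t) * h t) integrable_on {0..}"
    using laplace_mult_absolutely_integrable[OF h, of p] p by (simp add: absolutely_integrable_on_def)
  have "integral {0..} (\<lambda>t. exp (- p * of_real t) * ((of_real t + c) * h t))
    = integral {0..} (\<lambda>t. of_real t * exp (- p * of_real t) * h t + c * (exp (- p * of_real t) * h t))"
    by (rule integral_cong) (simp add: algebra_simps)
  also have "\<dots> = integral {0..} (\<lambda>t. of_real t * exp (- p * of_real t) * h t)
      + c * integral {0..} (\<lambda>t. exp (- p * of_real t) * h t)"
    using i1 i2 by (subst integral_add) (auto intro: integrable_on_mult_right)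
  finally have eq: "integral {0..} (\<lambda>t. exp (- p * of_real t) * ((of_real t + c) * h t)) = \<dots>" .
  show ?thesis
    unfolding eq by (rule derivative_eq_intros laplace_has_field_derivative[OF h p] refl)+ (simp add: algebra_simps)
qed

text \<open>Abelian limit: the integrands are dominated by \<open>norm (h t)\<close>. It fixes the
  constant left open by differentiation as the plain integral of the kernel.\<close>

lemma shifted_laplace_tendsto:
  fixes h :: "real \<Rightarrow> complex"
  assumes h: "h absolutely_integrable_on {0..}"
  shows "((\<lambda>r. exp (- of_real r * c) * integral {0..} (\<lambda>t. exp (- of_real r * of_real t) * h t))
    \<longlongrightarrow> integral {0..} h) (at_right 0)"
proof -
  have "((\<lambda>r. integral {0..} (\<lambda>t. exp (- complex_of_real r * of_real t) * h t)) \<longlongrightarrow> integral {0..} h) (at_right 0)"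
    unfolding tendsto_at_iff_sequentially comp_def
  proof (intro allI impI)
    fix X :: "nat \<Rightarrow> real" assume X: "\<forall>i. X i \<in> {0<..} - {0}" "X \<longlonglongrightarrow> 0"
    show "(\<lambda>i. integral {0..} (\<lambda>t. exp (- complex_of_real (X i) * of_real t) * h t)) \<longlonglongrightarrow> integral {0..} h"
    proof (rule dominated_convergence(2))
      show "(\<lambda>t. exp (- complex_of_real (X k) * of_real t) * h t) integrable_on {0..}" for k
        using laplace_absolutely_integrable[OF h, of "of_real (X k)"] X
        by (simp add: absolutely_integrable_on_def less_imp_le)
      show "(\<lambda>t. norm (h t)) integrable_on {0..}" using h by (simp add: absolutely_integrable_on_def)
      show "norm (exp (- complex_of_real (X k) * of_real t) * h t) \<le> norm (h t)" if "t \<in> {0..}" for k t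
        using that X(1) by (auto simp: norm_mult less_imp_le intro!: mult_left_le_one_le)
      fix t :: real
      have "(\<lambda>k. exp (- complex_of_real (X k) * of_real t) * h t) \<longlonglongrightarrow> exp (- complex_of_real 0 * of_real t) * h t"
        by (intro tendsto_intros X(2))
      then show "(\<lambda>k. exp (- complex_of_real (X k) * of_real t) * h t) \<longlonglongrightarrow> h t" by simp
    qed
  qed
  moreover have "((\<lambda>r. exp (- complex_of_real r * c)) \<longlongrightarrow> exp (- complex_of_real 0 * c)) (at_right 0)"
    by (intro tendsto_intros)
  ultimately show ?thesis using tendsto_mult by fastforce
qed

section \<open>The error function\<close>

lemma erf_0 [simp]: "erf 0 = 0" and erfc_0 [simp]: "erfc 0 = 1"
  by (simp_all add: erf_def erfc_def)

lemma has_integral_erf: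
  "((\<lambda>s. exp (- ((of_real s * z)\<^sup>2)) * z) has_integral of_real (sqrt pi) / 2 * erf z) {0..1}"
proof -
  have "(\<lambda>s. exp (- (s\<^sup>2))) contour_integrable_on (linepath 0 z)"
    by (intro contour_integrable_continuous_linepath continuous_intros)
  then have "((\<lambda>s. exp (- (s\<^sup>2))) has_contour_integral of_real (sqrt pi) / 2 * erf z) (linepath 0 z)"
    by (simp add: erf_def has_contour_integral_integral)
  then show ?thesis
    unfolding has_contour_integral_linepath by (simp add: linepath_def scaleR_conv_of_real)
qed

text \<open>The integrand is entire and hence has a primitive \<open>F\<close>; the contour integral
  over the segment is \<open>F z - F 0\<close>.\<close>

lemma has_field_derivative_erf:
  "(erf has_field_derivative 2 / of_real (sqrt pi) * exp (- (z\<^sup>2))) (at z)"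
proof -
  obtain F :: "complex \<Rightarrow> complex" where F: "\<And>z. (F has_field_derivative exp (- (z\<^sup>2))) (at z)"
  proof -
    have "(\<lambda>z::complex. exp (- (z\<^sup>2))) holomorphic_on UNIV" by (intro holomorphic_intros)
    then show ?thesis
    proof (rule holomorphic_convex_primitive'[OF convex_UNIV open_UNIV])
      fix g :: "complex \<Rightarrow> complex" assume "\<And>z. z \<in> UNIV \<Longrightarrow> (g has_field_derivative exp (- (z\<^sup>2))) (at z)"
      then show ?thesis using that[of g] by simp
    qed
  qed
  have "erf z = 2 / of_real (sqrt pi) * (F z - F 0)" for z
    using contour_integral_primitive[of UNIV F "\<lambda>z. exp (- (z\<^sup>2))" "linepath 0 z"] F
    by (simp add: erf_def contour_integral_unique)
  then have eq: "erf = (\<lambda>z. 2 / of_real (sqrt pi) * (F z - F 0))" by blast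
  show ?thesis unfolding eq by (auto intro!: derivative_eq_intros F)
qed

lemma has_field_derivative_erf' [derivative_intros]:
  assumes "(f has_field_derivative f') (at x within A)"
  shows "((\<lambda>x. erf (f x)) has_field_derivative 2 / of_real (sqrt pi) * exp (- ((f x)\<^sup>2)) * f') (at x within A)"
  using DERIV_chain2[OF has_field_derivative_erf assms] by simp

lemma has_field_derivative_erfc' [derivative_intros]:
  assumes "(f has_field_derivative f') (at x within A)"
  shows "((\<lambda>x. erfc (f x)) has_field_derivative - 2 / of_real (sqrt pi) * exp (- ((f x)\<^sup>2)) * f') (at x within A)"
  unfolding erfc_def by (auto intro!: derivative_eq_intros assms)

lemma tendsto_erf: "(f \<longlongrightarrow> l) F \<Longrightarrow> ((\<lambda>x. erf (f x)) \<longlongrightarrow> erf l) F"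
  by (rule isCont_tendsto_compose[OF DERIV_isCont[OF has_field_derivative_erf]])

lemma tendsto_erfc: "(f \<longlongrightarrow> l) F \<Longrightarrow> ((\<lambda>x. erfc (f x)) \<longlongrightarrow> erfc l) F"
  unfolding erfc_def by (intro tendsto_intros tendsto_erf)

lemma erf_mult_csqrt_has_field_derivative:
  assumes "Re p > 0"
  shows "((\<lambda>p. erf (a * csqrt p)) has_field_derivative a * exp (- p * a\<^sup>2) / (of_real (sqrt pi) * csqrt p)) (at p)"
proof -
  have "p \<notin> \<real>\<^sub>\<le>\<^sub>0" using assms by (auto simp: complex_nonpos_Reals_iff)
  then show ?thesis
    by (auto intro!: derivative_eq_intros simp: power_mult_distrib field_simps)
qed

lemma tendsto_mult_csqrt_of_real_0: "((\<lambda>r. a * csqrt (of_real r)) \<longlongrightarrow> 0) (at_right 0)"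
proof -
  have "((\<lambda>r. a * of_real (sqrt r)) \<longlongrightarrow> a * of_real (sqrt 0)) (at_right 0)"
    by (intro tendsto_intros)
  moreover have "eventually (\<lambda>r. a * of_real (sqrt r) = a * csqrt (of_real r)) (at_right 0)"
    using eventually_at_right_less by eventually_elim (simp add: csqrt_of_real)
  ultimately show ?thesis by (auto intro: Lim_transform_eventually)
qed

section \<open>Arctangents and the Gaussian mass of a sector\<close>

text \<open>The sum factors into \<open>a + \<i> * s * b\<close> and
  \<open>a - \<i> * s * b\<close>; if one of them vanished, \<open>a * cnj b\<close> would be purely
  imaginary. The hypothesis says that the directions of \<open>a\<close> and \<open>b\<close>
  enclose an acute angle.\<close>

lemma sum_squares_nonzero:
  assumes "Re (a * cnj b) > 0"
  shows "(of_real s * b)\<^sup>2 + a\<^sup>2 \<noteq> 0"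
proof
  assume "(of_real s * b)\<^sup>2 + a\<^sup>2 = 0"
  then have "(a + \<i> * of_real s * b) * (a - \<i> * of_real s * b) = 0"
    by (simp add: algebra_simps power2_eq_square)
  then have "a = - (\<i> * of_real s * b) \<or> a = \<i> * of_real s * b"
    by (auto simp: add_eq_0_iff2)
  then have "Re (a * cnj b) = 0"
    by (elim disjE) (simp_all add: algebra_simps)
  with assms show False by simp
qed

lemma Re_divide_pos: "Re (b / a) > 0" if "Re (a * cnj b) > 0"
proof -
  have "a \<noteq> 0" using that by auto
  have "b / a = cnj (a * cnj b) / of_real ((norm a)\<^sup>2)"
    by (simp add: complex_div_cnj[of b a] mult.commute)
  then have "Re (b / a) = Re (a * cnj b) / (norm a)\<^sup>2"
    by (simp only: Re_divide_of_real cnj.sel)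
  with that \<open>a \<noteq> 0\<close> show ?thesis by simp
qed

text \<open>The derivatives cancel on the right half-plane, and the value at 1 is twice
  \<open>pi / 4\<close>. The identity exchanges an arctangent at infinity for one at 0.\<close>

lemma Arctan_inverse_sum:
  assumes "Re z > 0"
  shows "Arctan z + Arctan (1 / z) = of_real (pi / 2)"
proof -
  have inv: "Re (1 / z) > 0" if "Re z > 0" for z
    using that Re_divide_pos[of z 1] by simp
  have "((\<lambda>z. Arctan z + Arctan (1 / z)) has_field_derivative 0) (at z within {z. Re z > 0})"
    if "z \<in> {z. Re z > 0}" for z
  proof -
    have z: "Re z > 0" "z \<noteq> 0" using that by auto
    have "z\<^sup>2 + 1 \<noteq> 0" using sum_squares_nonzero[of z 1 1] z by (simp add: add.commute)
    then have "inverse (1 + z\<^sup>2) + inverse (1 + (1 / z)\<^sup>2) * (- 1 / z\<^sup>2) = 0"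
      using z by (simp add: field_simps)
    moreover have "((\<lambda>z. Arctan z + Arctan (1 / z)) has_field_derivative
        inverse (1 + z\<^sup>2) + inverse (1 + (1 / z)\<^sup>2) * (- 1 / z\<^sup>2)) (at z)"
      using z inv[OF z(1)]
      by (auto intro!: derivative_eq_intros simp: power2_eq_square)
    ultimately show ?thesis by (metis has_field_derivative_at_within)
  qed
  then obtain c where c: "\<forall>z\<in>{z. Re z > 0}. Arctan z + Arctan (1 / z) = c"
    using has_field_derivative_zero_constant[OF convex_half_plane, of "\<lambda>z. Arctan z + Arctan (1 / z)"] by blast
  have "c = Arctan (of_real 1) + Arctan (of_real 1)" using c[rule_format, of 1] by simp
  also have "\<dots> = of_real (arctan 1 + arctan 1)" by (simp only: Arctan_of_real of_real_add)
  also have "arctan 1 + arctan 1 = pi / 2" by simp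
  finally have "c = of_real (pi / 2)" .
  then show ?thesis using c assms by simp
qed

text \<open>
  In polar coordinates, \<open>2 * a * b * sector_integral a b 1 / pi\<close> is the normalised Gaussian mass
  of the points \<open>(x, y)\<close> with \<open>x \<ge> a\<close> and \<open>0 \<le> y / x \<le> b / a\<close>; the parameter \<open>p\<close> scales
  \<open>a\<close> and \<open>b\<close> by \<open>\<surd>p\<close>.
\<close>

definition sector_integral :: "complex \<Rightarrow> complex \<Rightarrow> complex \<Rightarrow> complex" where
  "sector_integral a b p = integral {0..1} (\<lambda>s. exp (- p * ((of_real s * b)\<^sup>2 + a\<^sup>2)) / ((of_real s * b)\<^sup>2 + a\<^sup>2))"

lemma sector_integrand_continuous:
  assumes "Re (a * cnj b) > 0"
  shows "continuous_on S (\<lambda>s. exp (- p * ((of_real s * b)\<^sup>2 + a\<^sup>2)) / ((of_real s * b)\<^sup>2 + a\<^sup>2))"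
  using sum_squares_nonzero[OF assms] by (intro continuous_intros) auto

lemma sector_integral_has_field_derivative:
  assumes "Re (a * cnj b) > 0"
  shows "((\<lambda>p. sector_integral a b p) has_field_derivative
    - integral {0..1} (\<lambda>s. exp (- p * ((of_real s * b)\<^sup>2 + a\<^sup>2)))) (at p)"
proof -
  let ?c = "\<lambda>s. (complex_of_real s * b)\<^sup>2 + a\<^sup>2"
  have "((\<lambda>p. integral (cbox 0 1) (\<lambda>s. exp (- p * ?c s) / ?c s)) has_field_derivative
      integral (cbox 0 1) (\<lambda>s. - exp (- p * ?c s))) (at p within UNIV)"
  proof (rule leibniz_rule_field_derivative)
    fix q :: complex and s :: real
    show "((\<lambda>q. exp (- q * ?c s) / ?c s) has_field_derivative - exp (- q * ?c s)) (at q within UNIV)"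
    proof -
      have "((\<lambda>q. exp (- q * ?c s)) has_field_derivative exp (- q * ?c s) * - ?c s) (at q within UNIV)"
        by (rule derivative_eq_intros refl)+ simp
      from DERIV_cdivide[OF this, of "?c s"] show ?thesis
        using sum_squares_nonzero[OF assms, of s] by (simp only: mult_minus_right minus_divide_left nonzero_mult_div_cancel_right simp_thms divide_minus_left)
    qed
    show "(\<lambda>s. exp (- q * ?c s) / ?c s) integrable_on cbox 0 1"
      by (intro integrable_continuous sector_integrand_continuous assms)
    show "continuous_on (UNIV \<times> cbox 0 1) (\<lambda>(q, s). - exp (- q * ?c s))"
      unfolding split_beta by (intro continuous_intros)
  qed auto
  then show ?thesis by (simp add: sector_integral_def)
qed

text \<open>Once the \<open>p\<close>-derivative has cancelled the denominator, the exponential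
  splits into \<open>exp (- p * a\<^sup>2)\<close> and a Gaussian in \<open>s * b * csqrt p\<close>,
  whose integral is an \<open>erf\<close>.\<close>

lemma sector_integral_has_field_derivative_erf:
  assumes "Re (a * cnj b) > 0" "Re p > 0"
  shows "((\<lambda>p. sector_integral a b p) has_field_derivative
    - (of_real (sqrt pi) * exp (- p * a\<^sup>2) * erf (b * csqrt p) / (2 * b * csqrt p))) (at p)"
proof -
  have nz: "b \<noteq> 0" "csqrt p \<noteq> 0" using assms by auto
  have "((\<lambda>s. exp (- p * a\<^sup>2) / (b * csqrt p) * (exp (- ((of_real s * (b * csqrt p))\<^sup>2)) * (b * csqrt p)))
      has_integral exp (- p * a\<^sup>2) / (b * csqrt p) * (of_real (sqrt pi) / 2 * erf (b * csqrt p))) {0..1}"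
    by (intro has_integral_mult_right has_integral_erf)
  moreover have "exp (- p * a\<^sup>2) / (b * csqrt p) * (exp (- ((of_real s * (b * csqrt p))\<^sup>2)) * (b * csqrt p))
      = exp (- p * ((of_real s * b)\<^sup>2 + a\<^sup>2))" for s
    using nz by (simp add: power_mult_distrib algebra_simps flip: exp_add)
  ultimately have "((\<lambda>s. exp (- p * ((of_real s * b)\<^sup>2 + a\<^sup>2))) has_integral
      exp (- p * a\<^sup>2) / (b * csqrt p) * (of_real (sqrt pi) / 2 * erf (b * csqrt p))) {0..1}"
    by (simp only:)
  then have "integral {0..1} (\<lambda>s. exp (- p * ((of_real s * b)\<^sup>2 + a\<^sup>2)))
      = of_real (sqrt pi) * exp (- p * a\<^sup>2) * erf (b * csqrt p) / (2 * b * csqrt p)"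
    by (subst integral_unique) (auto simp: mult_ac)
  then show ?thesis using sector_integral_has_field_derivative[OF assms(1), of p] by simp
qed

text \<open>At \<open>p = 0\<close> the integrand is rational with primitive
  \<open>Arctan (s * b / a) / (a * b)\<close>. This is the boundary value in the comparison of
  functions of \<open>p\<close>.\<close>

lemma sector_integral_0:
  assumes "Re (a * cnj b) > 0"
  shows "sector_integral a b 0 = Arctan (b / a) / (a * b)"
proof -
  have nz: "a \<noteq> 0" "b \<noteq> 0" using assms by auto
  have ne: "(of_real s * b)\<^sup>2 + a\<^sup>2 \<noteq> 0" for s using sum_squares_nonzero[OF assms] .
  have "((\<lambda>s. 1 / ((of_real s * b)\<^sup>2 + a\<^sup>2)) has_integral
      Arctan (of_real 1 * (b / a)) / (a * b) - Arctan (of_real 0 * (b / a)) / (a * b)) {0..1}"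
  proof (rule fundamental_theorem_of_calculus)
    fix s :: real assume s: "s \<in> {0..1}"
    have "((\<lambda>z. Arctan (z * (b / a)) / (a * b)) has_field_derivative
        1 / ((of_real s * b)\<^sup>2 + a\<^sup>2)) (at (of_real s))"
    proof -
      have "Re (of_real s * (b / a)) = s * Re (b / a)"
        by (simp only: times_complex.sel Re_complex_of_real Im_complex_of_real mult_zero_left diff_zero)
      \<comment> \<open>The argument \<open>s * b / a\<close> meets the imaginary axis at
        \<open>s = 0\<close> only, where it is 0 and so lies between the branch points of
        \<open>Arctan\<close>.\<close>
      then have "Re (of_real s * (b / a)) = 0 \<Longrightarrow> s = 0"
        using Re_divide_pos[OF assms] by (metis less_irrefl mult_eq_0_iff)
      then have "Re (of_real s * (b / a)) = 0 \<Longrightarrow> \<bar>Im (of_real s * (b / a))\<bar> < 1" by auto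
      from DERIV_chain2[OF has_field_derivative_Arctan[OF this] DERIV_cmult_right[OF DERIV_ident]]
      have "((\<lambda>z. Arctan (z * (b / a)) / (a * b)) has_field_derivative
          inverse (1 + (of_real s * (b / a))\<^sup>2) * (1 * (b / a)) / (a * b)) (at (of_real s))"
        by (rule DERIV_cdivide)
      moreover have "inverse (1 + (of_real s * (b / a))\<^sup>2) * (1 * (b / a)) / (a * b)
          = 1 / ((of_real s * b)\<^sup>2 + a\<^sup>2)"
      proof -
        have "1 + (of_real s * (b / a))\<^sup>2 = ((of_real s * b)\<^sup>2 + a\<^sup>2) / a\<^sup>2"
          using nz by (simp add: field_simps)
        then show ?thesis using nz ne[of s] by (simp add: power2_eq_square)
      qed
      ultimately show ?thesis by simp
    qed
    then show "((\<lambda>s. Arctan (of_real s * (b / a)) / (a * b)) has_vector_derivative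
        1 / ((of_real s * b)\<^sup>2 + a\<^sup>2)) (at s within {0..1})"
      using has_vector_derivative_real_field has_vector_derivative_at_within by blast
  qed simp
  then show ?thesis by (simp add: sector_integral_def has_integral_iff)
qed

lemma sector_integral_tendsto:
  assumes "Re (a * cnj b) > 0"
  shows "((\<lambda>r. sector_integral a b (of_real r)) \<longlongrightarrow> Arctan (b / a) / (a * b)) (at_right 0)"
proof -
  have "((\<lambda>r. sector_integral a b (of_real r)) \<longlongrightarrow> sector_integral a b (of_real 0)) (at_right 0)"
    by (rule isCont_tendsto_compose[OF DERIV_isCont[OF sector_integral_has_field_derivative[OF assms]]])
       (intro tendsto_intros)
  then show ?thesis using sector_integral_0[OF assms] by simp
qed

text \<open>For positive real \<open>a\<close> this is the mass outside the square of side
  \<open>a\<close> in the quadrant: the diagonal cuts that region into two congruent sectors. In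
  general both sides have the same \<open>p\<close>-derivative and tend to 1, by
  \<open>Arctan 1 = pi / 4\<close>.\<close>

lemma one_minus_erf_squared_sector:
  assumes "Re a > 0"
  shows "1 - (erf a)\<^sup>2 = 4 * a\<^sup>2 / of_real pi * sector_integral a a 1"
proof -
  have aa: "Re (a * cnj a) > 0" using assms by (auto simp: add_pos_nonneg)
  have a: "a \<noteq> 0" using assms by auto
  have pi: "complex_of_real pi = of_real (sqrt pi) * of_real (sqrt pi)" by (simp flip: of_real_mult)
  have "1 - (erf (a * csqrt 1))\<^sup>2 = 4 * a\<^sup>2 / of_real pi * sector_integral a a 1"
  proof (rule complex_eq_on_half_plane[where p = 1 and f = "\<lambda>p. 1 - (erf (a * csqrt p))\<^sup>2"
        and g = "\<lambda>p. 4 * a\<^sup>2 / of_real pi * sector_integral a a p"])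
    fix p :: complex assume p: "Re p > 0"
    then have cp: "csqrt p \<noteq> 0" by auto
    show "((\<lambda>p. 1 - (erf (a * csqrt p))\<^sup>2) has_field_derivative
        - 2 * erf (a * csqrt p) * (a * exp (- p * a\<^sup>2) / (of_real (sqrt pi) * csqrt p))) (at p)"
      using DERIV_diff[OF DERIV_const DERIV_power[OF erf_mult_csqrt_has_field_derivative[OF p, of a], of 2], of 1]
      by (simp add: mult_ac)
    show "((\<lambda>p. 4 * a\<^sup>2 / of_real pi * sector_integral a a p) has_field_derivative
        - 2 * erf (a * csqrt p) * (a * exp (- p * a\<^sup>2) / (of_real (sqrt pi) * csqrt p))) (at p)"
      using DERIV_cmult[OF sector_integral_has_field_derivative_erf[OF aa p], of "4 * a\<^sup>2 / of_real pi"] a cp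
      by (simp add: pi power2_eq_square mult_ac)
  next
    have "((\<lambda>r. 1 - (erf (a * csqrt (of_real r)))\<^sup>2) \<longlongrightarrow> 1 - (erf 0)\<^sup>2) (at_right 0)"
      by (intro tendsto_intros tendsto_erf tendsto_mult_csqrt_of_real_0)
    then show "((\<lambda>r. 1 - (erf (a * csqrt (of_real r)))\<^sup>2) \<longlongrightarrow> 1) (at_right 0)" by simp
    have "((\<lambda>r. 4 * a\<^sup>2 / of_real pi * sector_integral a a (of_real r)) \<longlongrightarrow>
        4 * a\<^sup>2 / of_real pi * (Arctan (a / a) / (a * a))) (at_right 0)"
      by (intro tendsto_intros sector_integral_tendsto aa)
    moreover have "Arctan 1 = of_real (pi / 4)" using Arctan_of_real[of 1] by simp
    ultimately show "((\<lambda>r. 4 * a\<^sup>2 / of_real pi * sector_integral a a (of_real r)) \<longlongrightarrow> 1) (at_right 0)"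
      using a by (simp add: power2_eq_square)
  qed simp
  then show ?thesis by simp
qed

text \<open>With \<open>b = a\<close> the factor \<open>a\<^sup>2\<close> comes out of the
  denominator of the sector integrand, which leaves the real number
  \<open>s\<^sup>2 + 1\<close>.\<close>

lemma one_minus_erf_squared:
  fixes a :: complex
  assumes "Re a > 0"
  defines "h \<equiv> \<lambda>s::real. exp (- (a\<^sup>2) * of_real s ^ 2) / (of_real s ^ 2 + 1)"
  shows "h absolutely_integrable_on {0..1}"
    and "1 - (erf a)\<^sup>2 = 4 / of_real pi * exp (- (a\<^sup>2)) * integral {0..1} h"
proof -
  have a: "a \<noteq> 0" using assms by auto
  have ne: "complex_of_real s ^ 2 + 1 \<noteq> 0" for s
    using sum_squares_nonzero[of 1 1 s] by simp
  have "continuous_on {0..1} h"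
    unfolding h_def using ne by (intro continuous_intros) auto
  then show "h absolutely_integrable_on {0..1}"
    using absolutely_integrable_continuous_real by blast
  have "exp (- 1 * ((of_real s * a)\<^sup>2 + a\<^sup>2)) / ((of_real s * a)\<^sup>2 + a\<^sup>2) = exp (- (a\<^sup>2)) / a\<^sup>2 * h s" for s
  proof -
    have "(of_real s * a)\<^sup>2 + a\<^sup>2 = a\<^sup>2 * (of_real s ^ 2 + 1)"
      by (simp add: power_mult_distrib algebra_simps)
    moreover have "exp (- 1 * (a\<^sup>2 * (of_real s ^ 2 + 1))) = exp (- (a\<^sup>2)) * exp (- (a\<^sup>2) * of_real s ^ 2)"
      by (simp add: algebra_simps flip: exp_add)
    ultimately show ?thesis by (simp add: h_def)
  qed
  then have "sector_integral a a 1 = exp (- (a\<^sup>2)) / a\<^sup>2 * integral {0..1} h"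
    by (simp add: sector_integral_def)
  then show "1 - (erf a)\<^sup>2 = 4 / of_real pi * exp (- (a\<^sup>2)) * integral {0..1} h"
    using one_minus_erf_squared_sector[OF assms(1)] a by simp
qed

section \<open>Exponential decay of \<open>erfc\<close>\<close>

text \<open>For \<open>Re (z\<^sup>2) \<ge> 0\<close> the integrand has norm at most 1 on the unit
  interval; the constant 2 rounds up \<open>4 / pi\<close>.\<close>

lemma norm_one_minus_erf_squared_le:
  assumes "Re z > 0" "Re (z\<^sup>2) \<ge> 0"
  shows "norm (1 - (erf z)\<^sup>2) \<le> 2 * exp (- Re (z\<^sup>2))"
proof -
  let ?h = "\<lambda>s::real. exp (- (z\<^sup>2) * of_real s ^ 2) / (of_real s ^ 2 + 1)"
  have "norm (?h s) \<le> 1" for s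
  proof -
    have "complex_of_real s ^ 2 + 1 = of_real (s\<^sup>2 + 1)" by simp
    then have "norm (complex_of_real s ^ 2 + 1) = s\<^sup>2 + 1" by (simp only: norm_of_real) (simp add: add_nonneg_nonneg)
    moreover have "norm (exp (- (z\<^sup>2) * of_real s ^ 2)) \<le> 1"
      using assms(2) by (simp add: flip: of_real_power)
    ultimately show ?thesis by (simp add: norm_divide divide_le_eq_1 add_nonneg_pos add_increasing)
  qed
  then have "norm (integral {0..1} ?h) \<le> integral {0..1} (\<lambda>s::real. 1::real)"
    using one_minus_erf_squared(1)[OF assms(1)]
    by (intro integral_norm_bound_integral) (auto simp: absolutely_integrable_on_def)
  then have I: "norm (integral {0..1} ?h) \<le> 1" by simp
  have "norm (1 - (erf z)\<^sup>2) = 4 / pi * exp (- Re (z\<^sup>2)) * norm (integral {0..1} ?h)"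
    unfolding one_minus_erf_squared(2)[OF assms(1)] by (simp add: norm_mult norm_divide)
  also have "\<dots> \<le> 4 / pi * exp (- Re (z\<^sup>2)) * 1"
    by (intro mult_left_mono I) auto
  also have "\<dots> \<le> 2 * exp (- Re (z\<^sup>2))"
    using pi_ge_two by (simp add: field_simps)
  finally show ?thesis .
qed

text \<open>
  The identity for \<open>1 - (erf z)\<^sup>2\<close> bounds \<open>erfc z\<close> once \<open>erf z\<close> is known to stay away from \<open>-1\<close>;
  on the vertical segment from \<open>Re z\<close> to \<open>z\<close> its real part cannot change sign.
\<close>

lemma norm_erfc_le:
  assumes "Re z > 0" "Re (z\<^sup>2) \<ge> 1"
  shows "norm (erfc z) \<le> 2 * exp (- Re (z\<^sup>2))"
proof -
  have "Re (erf z) \<ge> 0"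
  proof (rule ccontr)
    assume neg: "\<not> Re (erf z) \<ge> 0"
    let ?x = "Re z" let ?S = "closed_segment (of_real ?x) z"
    have pos: "Re (erf (of_real ?x)) \<ge> 0"
    proof -
      have "((\<lambda>s. Re (exp (- ((of_real s * of_real ?x)\<^sup>2)) * of_real ?x)) has_integral
          Re (of_real (sqrt pi) / 2 * erf (of_real ?x))) {0..1}"
        by (rule has_integral_Re[OF has_integral_erf])
      moreover have "Re (exp (- ((of_real s * of_real ?x)\<^sup>2)) * of_real ?x) \<ge> 0" for s
      proof -
        have "exp (- ((complex_of_real s * of_real ?x)\<^sup>2)) * of_real ?x = of_real (exp (- ((s * ?x)\<^sup>2)) * ?x)"
          by (simp flip: exp_of_real)
        then show ?thesis using assms by simp
      qed
      ultimately have "Re (of_real (sqrt pi) / 2 * erf (of_real ?x)) \<ge> 0"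
        by (rule has_integral_nonneg)
      then show ?thesis using pi_gt_zero by (simp add: zero_le_mult_iff)
    qed
    have "continuous_on UNIV erf"
      using has_field_derivative_erf DERIV_isCont continuous_at_imp_continuous_on by blast
    then have "continuous_on ?S (\<lambda>z. Re (erf z))"
      by (intro continuous_intros) (auto elim: continuous_on_subset)
    then have conn: "connected ((\<lambda>z. Re (erf z)) ` ?S)"
      by (intro connected_continuous_image) auto
    have "Re (erf z) \<in> (\<lambda>z. Re (erf z)) ` ?S" "Re (erf (of_real ?x)) \<in> (\<lambda>z. Re (erf z)) ` ?S"
      by simp_all
    from connectedD_interval[OF conn this _ pos] have "0 \<in> (\<lambda>z. Re (erf z)) ` ?S"
      using neg by simp
    then obtain w where w: "w \<in> ?S" "Re (erf w) = 0" by auto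
    then obtain u where u: "0 \<le> u" "u \<le> 1" "w = (1 - u) *\<^sub>R of_real ?x + u *\<^sub>R z"
      by (auto simp: in_segment)
    have re: "Re w = ?x" and im: "Im w = u * Im z" unfolding u by (simp_all add: algebra_simps)
    \<comment> \<open>Towards the real end of the segment the imaginary part shrinks at fixed real
      part, so \<open>Re (w\<^sup>2)\<close> is at least \<open>Re (z\<^sup>2)\<close>.\<close>
    have "(u * Im z)\<^sup>2 \<le> (Im z)\<^sup>2"
      using u by (simp add: power_mult_distrib mult_left_le_one_le power_le_one)
    then have w1: "Re (w\<^sup>2) \<ge> 1" using assms(2) re im by (simp add: Re_power2)
    then have "norm (1 - (erf w)\<^sup>2) \<le> 2 * exp (- Re (w\<^sup>2))"
      using re assms by (intro norm_one_minus_erf_squared_le) auto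
    also have "\<dots> \<le> 2 * exp (- 1)" using w1 by simp
    \<comment> \<open>The threshold \<open>Re (z\<^sup>2) \<ge> 1\<close> makes the bound
      \<open>2 / exp 1 < 1\<close>, whereas a purely imaginary \<open>erf w\<close> gives
      \<open>Re (1 - (erf w)\<^sup>2) \<ge> 1\<close>.\<close>
    also have "\<dots> < 1" using exp_lower_Taylor_quadratic[of 1] by (simp add: exp_minus field_simps)
    finally have "norm (1 - (erf w)\<^sup>2) < 1" .
    moreover have "Re (1 - (erf w)\<^sup>2) \<ge> 1" using w(2) by (simp add: Re_power2)
    ultimately show False using complex_Re_le_cmod[of "1 - (erf w)\<^sup>2"] by linarith
  qed
  then have "norm (1 + erf z) \<ge> 1"
    using complex_Re_le_cmod[of "1 + erf z"] by simp
  \<comment> \<open>Here \<open>1 - (erf z)\<^sup>2 = erfc z * (1 + erf z)\<close>, and the second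
    factor has norm at least 1.\<close>
  then have "norm (erfc z) * 1 \<le> norm (erfc z) * norm (1 + erf z)"
    by (intro mult_left_mono) auto
  also have "\<dots> = norm (1 - (erf z)\<^sup>2)"
    by (simp add: erfc_def power2_eq_square algebra_simps flip: norm_mult)
  also have "\<dots> \<le> 2 * exp (- Re (z\<^sup>2))"
    using assms by (intro norm_one_minus_erf_squared_le) auto
  finally show ?thesis by simp
qed

section \<open>The Laplace transform of \<open>1 / csqrt (a\<^sup>2 + t)\<close>\<close>

lemma filterlim_of_real_sqrt: "filterlim (\<lambda>t. complex_of_real (sqrt t)) at_infinity at_top"
  by (rule filterlim_compose[OF filterlim_of_real_at_infinity sqrt_at_top])

lemma tendsto_inverse_sqrt: "((\<lambda>t. 1 / complex_of_real (sqrt t)) \<longlongrightarrow> 0) at_top"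
  using tendsto_divide_0[OF tendsto_const filterlim_of_real_sqrt] .

lemma csqrt_add_has_vector_derivative:
  assumes "c + of_real t \<notin> \<real>\<^sub>\<le>\<^sub>0"
  shows "((\<lambda>t. csqrt (c + of_real t)) has_vector_derivative 1 / (2 * csqrt (c + of_real t))) (at t)"
proof -
  have "((\<lambda>z. csqrt (c + z)) has_field_derivative 1 / (2 * csqrt (c + of_real t))) (at (of_real t))"
    using assms by (auto intro!: derivative_eq_intros)
  then show ?thesis by (rule has_vector_derivative_real_field)
qed

lemma continuous_on_csqrt_add:
  assumes "Re a > 0 \<or> a = 0"
  shows "continuous_on {0<..} (\<lambda>t. csqrt (a\<^sup>2 + of_real t))"
proof (rule continuous_at_imp_continuous_on, rule ballI)
  fix t :: real assume "t \<in> {0<..}"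
  then have "a\<^sup>2 + of_real t \<notin> \<real>\<^sub>\<le>\<^sub>0" using csqrt_add_pos(1)[OF assms, of t] by auto
  then show "isCont (\<lambda>t. csqrt (a\<^sup>2 + of_real t)) t"
    by (rule has_vector_derivative_continuous[OF csqrt_add_has_vector_derivative])
qed

text \<open>The principal root of \<open>a\<^sup>2\<close> is \<open>a\<close> itself, rather than
  \<open>- a\<close>, because \<open>a\<close> lies in the right half-plane; for
  \<open>a = 0\<close> the root is \<open>sqrt t\<close>.\<close>

lemma tendsto_csqrt_add_0:
  assumes "Re a > 0 \<or> a = 0"
  shows "((\<lambda>t. csqrt (a\<^sup>2 + of_real t)) \<longlongrightarrow> a) (at_right 0)"
proof (cases "a = 0")
  case True
  then show ?thesis using tendsto_mult_csqrt_of_real_0[of 1] by simp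
next
  case False
  have "((\<lambda>t. csqrt (a\<^sup>2 + of_real t)) \<longlongrightarrow> csqrt (a\<^sup>2 + of_real 0)) (at_right 0)"
  proof (rule isCont_tendsto_compose[of _ csqrt])
    show "isCont csqrt (a\<^sup>2 + of_real 0)"
      using csqrt_add_pos(1)[OF assms, of 0] False by (intro continuous_at_csqrt) auto
    show "((\<lambda>t. a\<^sup>2 + complex_of_real t) \<longlongrightarrow> a\<^sup>2 + of_real 0) (at_right 0)"
      by (intro tendsto_intros)
  qed
  then show ?thesis using assms False by (simp add: csqrt_square)
qed

text \<open>The limit is 1 for \<open>a = 0\<close> and 0 otherwise; the integrability criterion
  asks for its existence alone.\<close>

lemma tendsto_div_csqrt_add_0:
  assumes "Re a > 0 \<or> a = 0"
  obtains l where "((\<lambda>t. of_real (sqrt t) / csqrt (a\<^sup>2 + of_real t)) \<longlongrightarrow> l) (at_right 0)"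
proof (cases "a = 0")
  case True
  have "eventually (\<lambda>t. of_real (sqrt t) / csqrt (a\<^sup>2 + of_real t) = 1) (at_right 0)"
    using eventually_at_right_less by eventually_elim (simp add: True csqrt_of_real)
  then show ?thesis by (rule that[OF tendsto_eventually])
next
  case False
  have "((\<lambda>t. of_real (sqrt t) / csqrt (a\<^sup>2 + of_real t)) \<longlongrightarrow> of_real (sqrt 0) / a) (at_right 0)"
    by (intro tendsto_intros tendsto_csqrt_add_0 assms False)
  then show ?thesis by (rule that)
qed

lemma tendsto_div_csqrt_add_top:
  "((\<lambda>t. of_real (sqrt t) / csqrt (c + of_real t)) \<longlongrightarrow> 1) at_top"
  using tendsto_inverse[OF tendsto_csqrt_add_div_sqrt[of c]] by simp

lemma Re_csqrt_pos:
  assumes "Re p > 0"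
  shows "Re (csqrt p) > 0"
proof (rule ccontr)
  assume "\<not> Re (csqrt p) > 0"
  then have "Re (csqrt p) = 0" using csqrt_principal[of p] by auto
  then have "Re ((csqrt p)\<^sup>2) \<le> 0" unfolding Re_power2 by simp
  with assms show False by simp
qed

text \<open>A primitive is a multiple of \<open>erfc (csqrt (a\<^sup>2 + t) * csqrt p)\<close>: its
  Gaussian has exponent \<open>- p * (a\<^sup>2 + t)\<close>, and the inner derivative is half of
  \<open>csqrt p / csqrt (a\<^sup>2 + t)\<close>.\<close>

lemma has_integral_exp_div_csqrt:
  assumes p: "Re p > 0" and a: "Re a > 0 \<or> a = 0"
  shows "((\<lambda>t. exp (- p * of_real t) * (1 / csqrt (a\<^sup>2 + of_real t))) has_integral
    exp (p * a\<^sup>2) * of_real (sqrt pi) / csqrt p * erfc (a * csqrt p)) {0..}"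
proof -
  have cp: "csqrt p \<noteq> 0" "Re (csqrt p) > 0"
    using p Re_csqrt_pos by auto
  define f where "f t = exp (- p * of_real t) * (1 / csqrt (a\<^sup>2 + of_real t))" for t :: real
  define F where "F t = - (exp (p * a\<^sup>2) * of_real (sqrt pi) / csqrt p) * erfc (csqrt (a\<^sup>2 + of_real t) * csqrt p)" for t :: real
  have nz: "csqrt (a\<^sup>2 + of_real t) \<noteq> 0" if "t > 0" for t
    using csqrt_add_pos(2)[OF a, of t] that by auto
  have "f absolutely_integrable_on {0..}"
  proof -
    obtain l where l: "((\<lambda>t. of_real (sqrt t) / csqrt (a\<^sup>2 + of_real t)) \<longlongrightarrow> l) (at_right 0)"
      using tendsto_div_csqrt_add_0[OF a] .
    have eq: "of_real (sqrt t * (1 + t)) * f t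
        = of_real (sqrt t) / csqrt (a\<^sup>2 + of_real t) * (of_real (1 + t) * exp (- p * of_real t))" for t
      by (simp add: f_def)
    show ?thesis
    proof (rule absolutely_integrable_halfline)
      show "continuous_on {0<..} f"
        unfolding f_def using nz by (intro continuous_intros continuous_on_csqrt_add a) auto
      show "((\<lambda>t. of_real (sqrt t * (1 + t)) * f t) \<longlongrightarrow> l * (of_real (1 + 0) * exp (- p * of_real 0))) (at_right 0)"
        unfolding eq by (intro tendsto_intros l)
      have "((\<lambda>t. (1 + t) * exp (- (Re p * t))) \<longlongrightarrow> 0) at_top"
        using p by real_asymp
      then have "((\<lambda>t. norm (of_real (1 + t) * exp (- p * of_real t))) \<longlongrightarrow> 0) at_top"
      proof (rule Lim_transform_eventually)
        show "eventually (\<lambda>t. (1 + t) * exp (- (Re p * t)) = norm (of_real (1 + t) * exp (- p * of_real t))) at_top"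
          using eventually_gt_at_top[of 0]
        proof eventually_elim
          case (elim t)
          have "norm (of_real (1 + t) * exp (- p * of_real t)) = \<bar>1 + t\<bar> * exp (- (Re p * t))"
            unfolding norm_mult norm_of_real by simp
          then show ?case using elim by simp
        qed
      qed
      then have "((\<lambda>t. of_real (1 + t) * exp (- p * of_real t)) \<longlongrightarrow> 0) at_top"
        by (rule tendsto_norm_zero_cancel)
      then show "((\<lambda>t. of_real (sqrt t * (1 + t)) * f t) \<longlongrightarrow> 1 * 0) at_top"
        unfolding eq by (intro tendsto_mult tendsto_div_csqrt_add_top)
    qed
  qed
  moreover have "(F has_vector_derivative f t) (at t)" if t: "t > 0" for t
  proof -
    let ?X = "csqrt (a\<^sup>2 + of_real t)"
    have "((\<lambda>z. - (exp (p * a\<^sup>2) * of_real (sqrt pi) / csqrt p) * erfc (csqrt (a\<^sup>2 + z) * csqrt p)) has_field_derivative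
        - (exp (p * a\<^sup>2) * of_real (sqrt pi) / csqrt p) *
        (- 2 / of_real (sqrt pi) * exp (- ((?X * csqrt p)\<^sup>2)) * (1 / (2 * ?X) * csqrt p))) (at (of_real t))"
      using csqrt_add_pos(1)[OF a, of t] t
      by (intro DERIV_cmult has_field_derivative_erfc' DERIV_cmult_right has_field_derivative_csqrt'[THEN DERIV_cong])
         (auto intro!: derivative_eq_intros)
    moreover have "- (exp (p * a\<^sup>2) * of_real (sqrt pi) / csqrt p) *
        (- 2 / of_real (sqrt pi) * exp (- ((?X * csqrt p)\<^sup>2)) * (1 / (2 * ?X) * csqrt p)) = f t"
    proof -
      have "- ((?X * csqrt p)\<^sup>2) = - (p * a\<^sup>2) + - p * of_real t"
        by (simp add: power_mult_distrib algebra_simps)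
      then have "exp (- ((?X * csqrt p)\<^sup>2)) = exp (- (p * a\<^sup>2)) * exp (- p * of_real t)"
        by (simp only: exp_add)
      moreover have "exp (p * a\<^sup>2) * exp (- (p * a\<^sup>2)) = 1"
        by (simp flip: exp_add)
      moreover have "- (E * s / q) * (- 2 / s * (E' * u) * (1 / (2 * x) * q)) = u * (1 / x)"
        if "E * E' = 1" "s \<noteq> 0" "q \<noteq> 0" for E E' s q u x :: complex
        using that by (simp add: divide_simps)
      ultimately show ?thesis using cp(1) unfolding f_def by simp
    qed
    ultimately have "((\<lambda>z. - (exp (p * a\<^sup>2) * of_real (sqrt pi) / csqrt p) * erfc (csqrt (a\<^sup>2 + z) * csqrt p))
        has_field_derivative f t) (at (of_real t))" by metis
    then show ?thesis unfolding F_def by (rule has_vector_derivative_real_field)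
  qed
  moreover have "(F \<longlongrightarrow> - (exp (p * a\<^sup>2) * of_real (sqrt pi) / csqrt p) * erfc (a * csqrt p)) (at_right 0)"
    unfolding F_def by (intro tendsto_intros tendsto_erfc tendsto_csqrt_add_0 a)
  moreover have "(F \<longlongrightarrow> - (exp (p * a\<^sup>2) * of_real (sqrt pi) / csqrt p) * 0) at_top"
    unfolding F_def
  proof (intro tendsto_mult tendsto_const)
    \<comment> \<open>The decay estimate needs two facts for large \<open>t\<close>:
      \<open>Re (?z t) > 0\<close>, because \<open>?z t / sqrt t\<close> tends to
      \<open>csqrt p\<close>, and \<open>Re ((?z t)\<^sup>2) \<ge> 1\<close>, because this real part
      is affine in \<open>t\<close> with slope \<open>Re p\<close>.\<close>
    let ?z = "\<lambda>t::real. csqrt (a\<^sup>2 + of_real t) * csqrt p"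
    have sq: "Re ((?z t)\<^sup>2) = Re (a\<^sup>2 * p) + Re p * t" for t
      by (simp add: power_mult_distrib algebra_simps)
    have lim: "filterlim (\<lambda>t. Re (a\<^sup>2 * p) + Re p * t) at_top at_top"
      using p by real_asymp
    have "((\<lambda>t. ?z t / of_real (sqrt t)) \<longlongrightarrow> 1 * csqrt p) at_top"
      using tendsto_mult[OF tendsto_csqrt_add_div_sqrt[of "a\<^sup>2"] tendsto_const[of "csqrt p"]] by simp
    then have "((\<lambda>t. Re (?z t / of_real (sqrt t))) \<longlongrightarrow> Re (csqrt p)) at_top"
      using tendsto_Re by fastforce
    from order_tendstoD(1)[OF this cp(2)]
    have pos: "eventually (\<lambda>t. Re (?z t) > 0) at_top"
      using eventually_gt_at_top[of 0]
    proof eventually_elim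
      case (elim t)
      then show ?case by (simp only: Re_divide_of_real) (simp add: zero_less_divide_iff)
    qed
    show "((\<lambda>t. erfc (?z t)) \<longlongrightarrow> 0) at_top"
    proof (rule Lim_null_comparison)
      show "eventually (\<lambda>t. norm (erfc (?z t)) \<le> 2 * exp (- (Re (a\<^sup>2 * p) + Re p * t))) at_top"
        using pos lim[unfolded filterlim_at_top, rule_format, of 1]
      proof eventually_elim
        case (elim t)
        then show ?case using norm_erfc_le[of "?z t"] unfolding sq by simp
      qed
      show "((\<lambda>t. 2 * exp (- (Re (a\<^sup>2 * p) + Re p * t))) \<longlongrightarrow> 0) at_top"
        using p by real_asymp
    qed
  qed
  ultimately have "(f has_integral - (exp (p * a\<^sup>2) * of_real (sqrt pi) / csqrt p) * 0
      - - (exp (p * a\<^sup>2) * of_real (sqrt pi) / csqrt p) * erfc (a * csqrt p)) {0..}"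
    by (rule has_integral_FTC_halfline)
  then show ?thesis unfolding f_def by simp
qed

section \<open>The product of two complementary error functions\<close>

definition sum_kernel :: "complex \<Rightarrow> complex \<Rightarrow> real \<Rightarrow> complex" where
  "sum_kernel a b t = a * csqrt (b\<^sup>2 + of_real t) + b * csqrt (a\<^sup>2 + of_real t)"

definition product_kernel :: "complex \<Rightarrow> complex \<Rightarrow> real \<Rightarrow> complex" where
  "product_kernel a b t = sum_kernel a b t /
    ((csqrt (a\<^sup>2 + of_real t) * csqrt (b\<^sup>2 + of_real t) + a * b) *
     (csqrt (a\<^sup>2 + of_real t) * csqrt (b\<^sup>2 + of_real t)))"

lemma sum_kernel_commute: "sum_kernel a b t = sum_kernel b a t"
  by (simp add: sum_kernel_def)

lemma product_kernel_commute: "product_kernel a b t = product_kernel b a t"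
  by (simp add: product_kernel_def sum_kernel_commute[of a b] mult.commute)

text \<open>For nonzero entries \<open>Re (a * b) > 0\<close> is the half-plane form of
  \<open>\<bar>Arg a + Arg b\<bar> < pi / 2\<close>. One entry may be zero: the pair with
  \<open>a = 0\<close> yields the formula for a single \<open>erfc\<close>.\<close>

locale erfc_pair =
  fixes a b :: complex
  assumes a: "Re a > 0 \<or> a = 0" and b: "Re b > 0 \<or> b = 0"
    and ab: "Re (a * b) > 0 \<or> a = 0 \<or> b = 0" and nz: "a \<noteq> 0 \<or> b \<noteq> 0"
begin

lemma swap: "erfc_pair b a"
  using a b ab nz by unfold_locales (auto simp: mult.commute)

abbreviation "X t \<equiv> csqrt (a\<^sup>2 + complex_of_real t)"
abbreviation "Y t \<equiv> csqrt (b\<^sup>2 + complex_of_real t)"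
abbreviation "M t \<equiv> sum_kernel a b t"
abbreviation "Q t \<equiv> X t * Y t + a * b"

lemma Re_ab: "Re (a * b) \<ge> 0" using ab by (elim disjE) auto

context
  fixes t :: real
  assumes t: "t > 0"
begin

lemma Re_X: "Re (X t) > 0" and Re_Y: "Re (Y t) > 0"
  using csqrt_add_pos(2)[OF a, of t] csqrt_add_pos(2)[OF b, of t] t by simp_all

lemma X_nz: "X t \<noteq> 0" and Y_nz: "Y t \<noteq> 0"
  using Re_X Re_Y by auto

lemma Re_bX: "Re (b * X t) \<ge> 0" and Re_bX_pos: "b \<noteq> 0 \<Longrightarrow> Re (b * X t) > 0"
proof -
  show *: "Re (b * X t) > 0" if "b \<noteq> 0"
    using Re_mult_csqrt_add[OF a, of t b] t b that Re_ab by (simp add: mult.commute)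
  then show "Re (b * X t) \<ge> 0" by (cases "b = 0") (auto intro: less_imp_le)
qed

lemma Re_aY_pos: "a \<noteq> 0 \<Longrightarrow> Re (a * Y t) > 0"
  using Re_mult_csqrt_add[OF b, of t a] t a Re_ab by simp

text \<open>Both summands lie in the closed right half-plane and at least one in the open one, so
  they cannot cancel. This also puts \<open>t / M t\<close> into the right half-plane, away from the
  cuts of \<open>Arctan\<close>.\<close>

lemma Re_M: "Re (M t) > 0"
proof (cases "a = 0")
  case True
  then show ?thesis using nz Re_bX_pos by (simp add: sum_kernel_def)
next
  case False
  then show ?thesis using add_pos_nonneg[OF Re_aY_pos Re_bX] by (simp add: sum_kernel_def)
qed

lemma M_nz: "M t \<noteq> 0" using Re_M by auto

lemma Re_XY: "Re (X t * Y t) > 0"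
  using Re_mult_csqrt_add[OF b, of t "X t"] t Re_X Re_bX by (simp add: mult.commute)

text \<open>The product \<open>X t * Y t\<close> has positive and \<open>a * b\<close> nonnegative
  real part; hence the rewritten kernel has no pole for \<open>t > 0\<close>, whatever the sign of
  \<open>Re (a\<^sup>2 + b\<^sup>2)\<close>.\<close>

lemma Q_nz: "Q t \<noteq> 0"
proof -
  have "Re (Q t) > 0" using add_pos_nonneg[OF Re_XY Re_ab] by simp
  then show ?thesis by (metis less_irrefl zero_complex.sel(1))
qed

text \<open>A square root with positive real part is the principal one, so the root of the product
  splits without a change of sign.\<close>

lemma csqrt_mult_shifted: "csqrt ((a\<^sup>2 + of_real t) * (b\<^sup>2 + of_real t)) = X t * Y t"
  using Re_XY by (intro csqrt_unique) (auto simp: power_mult_distrib)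

lemma t_eq_X: "complex_of_real t = (X t)\<^sup>2 - a\<^sup>2" and t_eq_Y: "complex_of_real t = (Y t)\<^sup>2 - b\<^sup>2"
  by simp_all

lemma N_mult_Q: "(a * X t + b * Y t) * Q t = (a\<^sup>2 + b\<^sup>2 + of_real t) * M t"
proof -
  have *: "(a * x + b * y) * (x * y + a * b) = (a\<^sup>2 + y\<^sup>2) * (a * y + b * x)"
    if "y\<^sup>2 - b\<^sup>2 = x\<^sup>2 - a\<^sup>2" for x y
    using that by algebra
  have "a\<^sup>2 + b\<^sup>2 + of_real t = a\<^sup>2 + (Y t)\<^sup>2" by simp
  then show ?thesis using *[of "Y t" "X t"] t_eq_X t_eq_Y by (simp only: sum_kernel_def)
qed

text \<open>The difference \<open>(Q t)\<^sup>2 - (M t)\<^sup>2\<close> factors as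
  \<open>((X t)\<^sup>2 - a\<^sup>2) * ((Y t)\<^sup>2 - b\<^sup>2)\<close>, and both factors equal
  \<open>t\<close>.\<close>

lemma Q_squared: "(Q t)\<^sup>2 = (M t)\<^sup>2 + (of_real t)\<^sup>2"
proof -
  have *: "(x * y + a * b)\<^sup>2 = (a * y + b * x)\<^sup>2 + s\<^sup>2" if "s = x\<^sup>2 - a\<^sup>2" "s = y\<^sup>2 - b\<^sup>2" for x y s
    using that by algebra
  show ?thesis unfolding sum_kernel_def by (rule *[OF t_eq_X t_eq_Y])
qed

text \<open>At the excluded \<open>t\<close> the quotient takes the default value 0 of a division by
  zero, while the regular kernel is nonzero there.\<close>

lemma integrand_eq_product_kernel:
  assumes "a\<^sup>2 + b\<^sup>2 + of_real t \<noteq> 0"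
  shows "(a * X t + b * Y t) / ((a\<^sup>2 + b\<^sup>2 + of_real t) * csqrt ((a\<^sup>2 + of_real t) * (b\<^sup>2 + of_real t)))
    = product_kernel a b t"
  unfolding csqrt_mult_shifted product_kernel_def
  using N_mult_Q X_nz Y_nz Q_nz assms by (simp add: frac_eq_eq)

text \<open>Multiplication by the factor that a \<open>p\<close>-derivative brings down splits the
  kernel into two summands whose Laplace transforms are known.\<close>

lemma mult_product_kernel:
  "(of_real t + (a\<^sup>2 + b\<^sup>2)) * product_kernel a b t = a * (1 / Y t) + b * (1 / X t)"
proof -
  have *: "s * (m / (q * (x * y))) = a * (1 / y) + b * (1 / x)"
    if "(a * x + b * y) * q = s * m" "q \<noteq> 0" "x \<noteq> 0" "y \<noteq> 0" for s m q x y
  proof -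
    have "s * (m / (q * (x * y))) = (a * x + b * y) * q / (q * (x * y))" using that by simp
    also have "\<dots> = a * (1 / y) + b * (1 / x)" using that by (simp add: divide_simps)
    finally show ?thesis .
  qed
  have "(a * X t + b * Y t) * Q t = (of_real t + (a\<^sup>2 + b\<^sup>2)) * M t"
    using N_mult_Q by (simp add: add_ac)
  from *[OF this Q_nz X_nz Y_nz] show ?thesis unfolding product_kernel_def .
qed

text \<open>With the triple \<open>Q\<^sup>2 = M\<^sup>2 + t\<^sup>2\<close>, the kernel is the derivative of \<open>2 Arctan (t / M)\<close>.\<close>

lemma Arctan_primitive:
  "((\<lambda>t. 2 * Arctan (of_real t / M t)) has_vector_derivative product_kernel a b t) (at t)"
proof -
  let ?M = "\<lambda>z. a * csqrt (b\<^sup>2 + z) + b * csqrt (a\<^sup>2 + z)"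
  have dX: "((\<lambda>z. csqrt (a\<^sup>2 + z)) has_field_derivative 1 / (2 * X t)) (at (of_real t))"
    using csqrt_add_pos(1)[OF a, of t] t by (auto intro!: derivative_eq_intros)
  have dY: "((\<lambda>z. csqrt (b\<^sup>2 + z)) has_field_derivative 1 / (2 * Y t)) (at (of_real t))"
    using csqrt_add_pos(1)[OF b, of t] t by (auto intro!: derivative_eq_intros)
  have dM: "(?M has_field_derivative a * (1 / (2 * Y t)) + b * (1 / (2 * X t))) (at (of_real t))"
    by (intro DERIV_add DERIV_cmult dX dY)
  have M: "?M (of_real t) = M t" by (simp add: sum_kernel_def)
  have "Re (of_real t / M t) > 0"
    using Re_divide_pos[of "M t" "of_real t"] Re_M t by simp
  then have "(Arctan has_field_derivative inverse (1 + (of_real t / ?M (of_real t))\<^sup>2)) (at (of_real t / ?M (of_real t)))"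
    unfolding M by (intro has_field_derivative_Arctan) simp
  from DERIV_cmult[OF DERIV_chain2[OF this DERIV_divide[OF DERIV_ident dM]], of 2]
  have "((\<lambda>z. 2 * Arctan (z / ?M z)) has_field_derivative
      2 * (inverse (1 + (of_real t / M t)\<^sup>2) *
        ((1 * M t - of_real t * (a * (1 / (2 * Y t)) + b * (1 / (2 * X t)))) / (M t * M t)))) (at (of_real t))"
    unfolding M using M_nz by blast
  moreover have "2 * (inverse (1 + (of_real t / M t)\<^sup>2) *
        ((1 * M t - of_real t * (a * (1 / (2 * Y t)) + b * (1 / (2 * X t)))) / (M t * M t))) = product_kernel a b t"
  proof -
    have 1: "1 + (of_real t / M t)\<^sup>2 = (Q t)\<^sup>2 / (M t)\<^sup>2"
      using M_nz by (simp add: Q_squared add_divide_distrib power_divide)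
    \<comment> \<open>The derivative of \<open>M\<close> is
      \<open>(a * X + b * Y) / (2 * X * Y)\<close>; this identity turns the numerator
      \<open>M - t * M'\<close> of the quotient rule into
      \<open>M * Q / (2 * X * Y)\<close>.\<close>
    have "of_real t * (a * X t + b * Y t) = M t * (X t * Y t - a * b)"
    proof -
      have *: "s * (a * x + b * y) = (a * y + b * x) * (x * y - a * b)"
        if "s = x\<^sup>2 - a\<^sup>2" "s = y\<^sup>2 - b\<^sup>2" for x y s
        using that by algebra
      show ?thesis unfolding sum_kernel_def by (rule *[OF t_eq_X t_eq_Y])
    qed
    moreover have "m - s * (a * (1 / (2 * y)) + b * (1 / (2 * x))) = m * (x * y + a * b) / (2 * (x * y))"
      if "s * (a * x + b * y) = m * (x * y - a * b)" "x \<noteq> 0" "y \<noteq> 0" for m s x y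
    proof -
      have "s * (a * (1 / (2 * y)) + b * (1 / (2 * x))) = s * (a * x + b * y) / (2 * (x * y))"
        using that(2,3) by (simp add: divide_simps)
      then show ?thesis using that by (simp add: divide_simps) (simp add: algebra_simps)
    qed
    ultimately have 2: "M t - of_real t * (a * (1 / (2 * Y t)) + b * (1 / (2 * X t))) = M t * Q t / (2 * (X t * Y t))"
      using X_nz Y_nz by blast
    have *: "2 * (inverse (q\<^sup>2 / m\<^sup>2) * ((m * q / (2 * w)) / (m * m))) = m / (q * w)"
      if "m \<noteq> 0" "q \<noteq> 0" for m q w :: complex
      using that by (simp add: power2_eq_square divide_simps)
    show ?thesis unfolding 1 mult_1 2 product_kernel_def by (rule *[OF M_nz Q_nz])
  qed
  ultimately have "((\<lambda>z. 2 * Arctan (z / ?M z)) has_field_derivative product_kernel a b t) (at (of_real t))"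
    by simp
  from has_vector_derivative_real_field[OF this] show ?thesis by (simp add: sum_kernel_def)
qed

end

text \<open>For \<open>a = 0\<close> the kernel is \<open>b / (sqrt t * (Y t)\<^sup>2)\<close>, a
  singularity that the weight \<open>sqrt t\<close> just cancels, and \<open>t / M t\<close> reduces
  to \<open>X t / b\<close>.\<close>

lemma kernel_limits_0_left:
  assumes a0: "a = 0"
  shows "\<exists>l. ((\<lambda>t. of_real (sqrt t * (1 + t)) * product_kernel a b t) \<longlongrightarrow> l) (at_right 0)"
    and "((\<lambda>t. of_real t / M t) \<longlongrightarrow> 0) (at_right 0)"
proof -
    have b0: "b \<noteq> 0" using nz a0 by simp
    have s: "csqrt (of_real t) = of_real (sqrt t)" if "t > 0" for t using that by (simp add: csqrt_of_real)
    have "((\<lambda>t. of_real (1 + t) * b / (Y t)\<^sup>2) \<longlongrightarrow> of_real (1 + 0) * b / b\<^sup>2) (at_right 0)"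
      using b0 by (intro tendsto_intros tendsto_csqrt_add_0 b) auto
    moreover have "eventually (\<lambda>t. of_real (1 + t) * b / (Y t)\<^sup>2 = of_real (sqrt t * (1 + t)) * product_kernel a b t) (at_right 0)"
      using eventually_at_right_less
    proof eventually_elim
      case (elim t)
      have *: "c * b / y\<^sup>2 = r * c * (b * r / ((r * y) * (r * y)))" if "r \<noteq> 0" for r c y
        using that by (simp add: power2_eq_square)
      show ?case
        using *[of "of_real (sqrt t)" "of_real (1 + t)" "Y t"] elim s[of t] unfolding product_kernel_def sum_kernel_def a0 by simp
    qed
    ultimately show "\<exists>l. ((\<lambda>t. of_real (sqrt t * (1 + t)) * product_kernel a b t) \<longlongrightarrow> l) (at_right 0)"
      by (blast intro: Lim_transform_eventually)
    have "((\<lambda>t. X t / b) \<longlongrightarrow> a / b) (at_right 0)"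
      using b0 by (intro tendsto_intros tendsto_csqrt_add_0 a) auto
    moreover have "eventually (\<lambda>t. X t / b = of_real t / sum_kernel a b t) (at_right 0)"
      using eventually_at_right_less
    proof eventually_elim
      case (elim t)
      have "X t / b = (X t)\<^sup>2 / (b * X t)" using X_nz[OF elim] by (simp add: power2_eq_square)
      then show ?case by (simp add: sum_kernel_def a0)
    qed
    ultimately show "((\<lambda>t. of_real t / sum_kernel a b t) \<longlongrightarrow> 0) (at_right 0)"
      using a0 by (auto intro: Lim_transform_eventually)
qed

lemma kernel_limits_0:
  shows "\<exists>l. ((\<lambda>t. of_real (sqrt t * (1 + t)) * product_kernel a b t) \<longlongrightarrow> l) (at_right 0)"
    and "((\<lambda>t. of_real t / M t) \<longlongrightarrow> 0) (at_right 0)"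
proof -
  have "(\<exists>l. ((\<lambda>t. of_real (sqrt t * (1 + t)) * product_kernel a b t) \<longlongrightarrow> l) (at_right 0)) \<and>
      ((\<lambda>t. of_real t / M t) \<longlongrightarrow> 0) (at_right 0)"
  proof -
    consider "a = 0" | "b = 0" | "a \<noteq> 0" "b \<noteq> 0" by blast
    then show ?thesis
    proof cases
      case 1
      then show ?thesis using kernel_limits_0_left by simp
    next
      case 2
      then show ?thesis 
        using erfc_pair.kernel_limits_0_left[OF swap 2]
        unfolding product_kernel_commute[of a b] sum_kernel_commute[of a b] by blast
    next
      case 3
      have M0: "(M \<longlongrightarrow> a * b + b * a) (at_right 0)"
        unfolding sum_kernel_def by (intro tendsto_intros tendsto_csqrt_add_0 a b)
      have "((\<lambda>t. of_real (sqrt t * (1 + t)) * product_kernel a b t) \<longlongrightarrow>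
          of_real (sqrt 0 * (1 + 0)) * ((a * b + b * a) / ((a * b + a * b) * (a * b)))) (at_right 0)"
        unfolding product_kernel_def using 3
        by (intro tendsto_intros M0 tendsto_csqrt_add_0 a b) auto
      moreover have "((\<lambda>t. of_real t / M t) \<longlongrightarrow> of_real 0 / (a * b + b * a)) (at_right 0)"
        using 3 by (intro tendsto_intros M0) auto
      ultimately show ?thesis by auto
    qed
  qed
  then show "\<exists>l. ((\<lambda>t. of_real (sqrt t * (1 + t)) * product_kernel a b t) \<longlongrightarrow> l) (at_right 0)"
    and "((\<lambda>t. of_real t / M t) \<longlongrightarrow> 0) (at_right 0)" by blast+
qed

text \<open>Dividing every root by \<open>sqrt t\<close> shows that the kernel is asymptotic to
  \<open>(a + b) / t powr (3/2)\<close>.\<close>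

lemma product_kernel_tendsto_top:
  "((\<lambda>t. of_real (sqrt t * (1 + t)) * product_kernel a b t) \<longlongrightarrow> a + b) at_top"
proof -
  let ?r = "\<lambda>t. complex_of_real (sqrt t)"
  have "((\<lambda>t. ((1 / ?r t) * (1 / ?r t) + 1) * ((a * (Y t / ?r t) + b * (X t / ?r t)) /
      (((X t / ?r t) * (Y t / ?r t) + a * b * ((1 / ?r t) * (1 / ?r t))) * ((X t / ?r t) * (Y t / ?r t)))))
      \<longlongrightarrow> (0 * 0 + 1) * ((a * 1 + b * 1) / ((1 * 1 + a * b * (0 * 0)) * (1 * 1)))) at_top"
    by (intro tendsto_intros tendsto_inverse_sqrt tendsto_csqrt_add_div_sqrt) auto
  moreover have "eventually (\<lambda>t. ((1 / ?r t) * (1 / ?r t) + 1) * ((a * (Y t / ?r t) + b * (X t / ?r t)) /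
      (((X t / ?r t) * (Y t / ?r t) + a * b * ((1 / ?r t) * (1 / ?r t))) * ((X t / ?r t) * (Y t / ?r t))))
      = of_real (sqrt t * (1 + t)) * product_kernel a b t) at_top"
    using eventually_gt_at_top[of 0]
  proof eventually_elim
    case (elim t)
    have *: "((1 / r) * (1 / r) + 1) * ((a * (y / r) + b * (x / r)) /
        (((x / r) * (y / r) + a * b * ((1 / r) * (1 / r))) * ((x / r) * (y / r))))
        = r * (1 + r * r) * ((a * y + b * x) / ((x * y + a * b) * (x * y)))"
      if "r \<noteq> 0" "x \<noteq> 0" "y \<noteq> 0" "x * y + a * b \<noteq> 0" for r x y
    proof -
      have 1: "(x / r) * (y / r) + a * b * ((1 / r) * (1 / r)) = (x * y + a * b) / (r * r)"
        by (simp add: add_divide_distrib)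
      have 2: "a * (y / r) + b * (x / r) = (a * y + b * x) / r" by (simp add: add_divide_distrib)
      have 3: "(1 / r) * (1 / r) + 1 = (1 + r * r) / (r * r)" using that by (simp add: divide_simps)
      show ?thesis unfolding 1 2 3 using that by simp
    qed
    have "?r t * (1 + ?r t * ?r t) = of_real (sqrt t * (1 + t))"
    proof -
      have "?r t * ?r t = of_real t" using elim by (simp flip: of_real_mult)
      then show ?thesis by simp
    qed
    with *[OF _ X_nz Y_nz Q_nz, of "?r t" t] elim show ?case
      by (simp only: product_kernel_def sum_kernel_def) simp
  qed
  ultimately show ?thesis by (simp add: Lim_transform_eventually)
qed

lemma product_kernel_absolutely_integrable: "product_kernel a b absolutely_integrable_on {0..}"
proof -
  obtain l where "((\<lambda>t. of_real (sqrt t * (1 + t)) * product_kernel a b t) \<longlongrightarrow> l) (at_right 0)"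
    using kernel_limits_0(1) by blast
  moreover have "continuous_on {0<..} (product_kernel a b)"
    unfolding product_kernel_def sum_kernel_def using X_nz Y_nz Q_nz
    by (intro continuous_intros continuous_on_csqrt_add a b) auto
  ultimately show ?thesis
    using absolutely_integrable_halfline product_kernel_tendsto_top by blast
qed

text \<open>The primitive \<open>2 * Arctan (t / M t)\<close> runs from 0 to \<open>pi\<close> for
  every admissible pair; this is the source of the factor \<open>1 / pi\<close> in the product
  formula.\<close>

lemma integral_product_kernel: "integral {0..} (product_kernel a b) = of_real pi"
proof -
  have "(product_kernel a b has_integral 2 * of_real (pi / 2) - 2 * Arctan 0) {0..}"
  proof (rule has_integral_FTC_halfline[OF product_kernel_absolutely_integrable Arctan_primitive])
    show "((\<lambda>t. 2 * Arctan (of_real t / M t)) \<longlongrightarrow> 2 * Arctan 0) (at_right 0)"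
      by (intro tendsto_mult tendsto_const isCont_tendsto_compose[OF continuous_at_Arctan] kernel_limits_0(2)) auto
    have "((\<lambda>t. (a * (Y t / of_real (sqrt t)) + b * (X t / of_real (sqrt t))) * (1 / of_real (sqrt t)))
        \<longlongrightarrow> (a * 1 + b * 1) * 0) at_top"
      by (intro tendsto_intros tendsto_inverse_sqrt tendsto_csqrt_add_div_sqrt)
    moreover have "eventually (\<lambda>t. (a * (Y t / of_real (sqrt t)) + b * (X t / of_real (sqrt t))) * (1 / of_real (sqrt t))
        = M t / of_real t) at_top"
      using eventually_gt_at_top[of 0]
    proof eventually_elim
      case (elim t)
      have "complex_of_real t = of_real (sqrt t) * of_real (sqrt t)"
        using elim by (simp flip: of_real_mult)
      then show ?case by (simp only: sum_kernel_def) (simp add: add_divide_distrib)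
    qed
    ultimately have lim: "((\<lambda>t. M t / of_real t) \<longlongrightarrow> 0) at_top"
      by (simp add: Lim_transform_eventually)
    \<comment> \<open>The quotient \<open>t / M t\<close> is unbounded, so continuity of
      \<open>Arctan\<close> is applied to its reciprocal, which tends to 0.\<close>
    have "((\<lambda>t. 2 * (of_real (pi / 2) - Arctan (M t / of_real t))) \<longlongrightarrow> 2 * (of_real (pi / 2) - Arctan 0)) at_top"
      by (intro tendsto_intros isCont_tendsto_compose[OF continuous_at_Arctan] lim) auto
    moreover have "eventually (\<lambda>t. 2 * (of_real (pi / 2) - Arctan (M t / of_real t)) = 2 * Arctan (of_real t / M t)) at_top"
      using eventually_gt_at_top[of 0]
    proof eventually_elim
      case (elim t)
      have "Re (of_real t / M t) > 0"
        using Re_divide_pos[of "M t" "of_real t"] Re_M elim by simp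
      from Arctan_inverse_sum[OF this]
      have "of_real (pi / 2) - Arctan (M t / of_real t) = Arctan (of_real t / M t)"
        by (simp add: algebra_simps)
      then show ?case by simp
    qed
    ultimately show "((\<lambda>t. 2 * Arctan (of_real t / M t)) \<longlongrightarrow> 2 * of_real (pi / 2)) at_top"
      by (simp add: Lim_transform_eventually)
  qed auto
  then show ?thesis by (simp add: integral_unique)
qed

text \<open>As \<open>p\<close> tends to 0 both sides tend to 1: \<open>erfc 0 = 1\<close> on the
  left, total kernel integral \<open>pi\<close> on the right. The \<open>p\<close>-derivatives agree
  because the kernel multiplied by \<open>t + a\<^sup>2 + b\<^sup>2\<close> is
  \<open>a / Y t + b / X t\<close>.\<close>

lemma erfc_product:
  assumes "Re p > 0"
  shows "erfc (a * csqrt p) * erfc (b * csqrt p) =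
    1 / of_real pi * (exp (- p * (a\<^sup>2 + b\<^sup>2)) * integral {0..} (\<lambda>t. exp (- p * of_real t) * product_kernel a b t))"
proof (rule complex_eq_on_half_plane[where f = "\<lambda>p. erfc (a * csqrt p) * erfc (b * csqrt p)" and
      g = "\<lambda>p. 1 / of_real pi * (exp (- p * (a\<^sup>2 + b\<^sup>2)) * integral {0..} (\<lambda>t. exp (- p * of_real t) * product_kernel a b t))"])
  fix p :: complex assume p: "Re p > 0"
  let ?s = "complex_of_real (sqrt pi)"
  have cp: "csqrt p \<noteq> 0" using p by auto
  have s: "complex_of_real pi = ?s * ?s" "?s \<noteq> 0" by (simp_all flip: of_real_mult)
  let ?D = "- (a * exp (- p * a\<^sup>2) / (?s * csqrt p) * erfc (b * csqrt p) + b * exp (- p * b\<^sup>2) / (?s * csqrt p) * erfc (a * csqrt p))"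
  show "((\<lambda>p. erfc (a * csqrt p) * erfc (b * csqrt p)) has_field_derivative ?D) (at p)"
  proof -
    have D: "((\<lambda>p. erfc (c * csqrt p)) has_field_derivative - (c * exp (- p * c\<^sup>2) / (?s * csqrt p))) (at p)" for c
      unfolding erfc_def using DERIV_diff[OF DERIV_const erf_mult_csqrt_has_field_derivative[OF p, of c], of 1] by simp
    show ?thesis using DERIV_mult'[OF D[of a] D[of b]] by (simp add: algebra_simps)
  qed
  have "integral {0..} (\<lambda>t. exp (- p * of_real t) * ((of_real t + (a\<^sup>2 + b\<^sup>2)) * product_kernel a b t))
      = a * (exp (p * b\<^sup>2) * ?s / csqrt p * erfc (b * csqrt p)) + b * (exp (p * a\<^sup>2) * ?s / csqrt p * erfc (a * csqrt p))"
  proof (rule integral_unique, rule has_integral_spike[OF negligible_sing[of 0]])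
    show "((\<lambda>t. a * (exp (- p * of_real t) * (1 / Y t)) + b * (exp (- p * of_real t) * (1 / X t))) has_integral
        a * (exp (p * b\<^sup>2) * ?s / csqrt p * erfc (b * csqrt p)) + b * (exp (p * a\<^sup>2) * ?s / csqrt p * erfc (a * csqrt p))) {0..}"
      by (intro has_integral_add has_integral_mult_right has_integral_exp_div_csqrt p a b)
    fix t :: real assume "t \<in> {0..} - {0}"
    then have "t > 0" by auto
    then show "exp (- p * of_real t) * ((of_real t + (a\<^sup>2 + b\<^sup>2)) * product_kernel a b t)
        = a * (exp (- p * of_real t) * (1 / Y t)) + b * (exp (- p * of_real t) * (1 / X t))"
      unfolding mult_product_kernel[OF \<open>t > 0\<close>] by (simp only: distrib_left mult.left_commute)
  qed
  note eq = DERIV_cmult[OF shifted_laplace_has_field_derivative[OF product_kernel_absolutely_integrable p, of "a\<^sup>2 + b\<^sup>2"],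
      of "1 / of_real pi", unfolded this]
  have "1 / of_real pi * (- exp (- p * (a\<^sup>2 + b\<^sup>2)) *
      (a * (exp (p * b\<^sup>2) * ?s / csqrt p * erfc (b * csqrt p)) + b * (exp (p * a\<^sup>2) * ?s / csqrt p * erfc (a * csqrt p)))) = ?D"
  proof -
    have e: "exp (- p * (a\<^sup>2 + b\<^sup>2)) = exp (- p * a\<^sup>2) * exp (- p * b\<^sup>2)"
      by (simp add: algebra_simps flip: exp_add)
    have u: "exp (- p * a\<^sup>2) * exp (p * a\<^sup>2) = 1" "exp (- p * b\<^sup>2) * exp (p * b\<^sup>2) = 1"
      by (simp_all flip: exp_add)
    have *: "1 / (s * s) * (- (A * B) * (a * (B' * s / q * F) + b * (A' * s / q * G))) = - (a * A / (s * q) * F + b * B / (s * q) * G)"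
      if "A * A' = 1" "B * B' = 1" "s \<noteq> 0" "q \<noteq> 0" for A B A' B' F G s q
    proof -
      have "1 / (s * s) * (- (A * B) * (a * (B' * s / q * F) + b * (A' * s / q * G)))
          = - (a * A * (B * B') / (s * q) * F + b * B * (A * A') / (s * q) * G)"
        using that(3,4) by (simp add: divide_simps) (simp add: algebra_simps)
      then show ?thesis using that by simp
    qed
    show ?thesis unfolding e s(1) by (rule *[OF u s(2) cp])
  qed
  then show "((\<lambda>p. 1 / of_real pi * (exp (- p * (a\<^sup>2 + b\<^sup>2)) * integral {0..} (\<lambda>t. exp (- p * of_real t) * product_kernel a b t)))
      has_field_derivative ?D) (at p)"
    using eq by metis
next
  have "((\<lambda>r. erfc (a * csqrt (of_real r)) * erfc (b * csqrt (of_real r))) \<longlongrightarrow> erfc 0 * erfc 0) (at_right 0)"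
    by (intro tendsto_intros tendsto_erfc tendsto_mult_csqrt_of_real_0)
  then show "((\<lambda>r. erfc (a * csqrt (of_real r)) * erfc (b * csqrt (of_real r))) \<longlongrightarrow> 1) (at_right 0)" by simp
  have "((\<lambda>r. 1 / of_real pi * (exp (- of_real r * (a\<^sup>2 + b\<^sup>2)) * integral {0..} (\<lambda>t. exp (- of_real r * of_real t) * product_kernel a b t)))
      \<longlongrightarrow> 1 / of_real pi * of_real pi) (at_right 0)"
    using shifted_laplace_tendsto[OF product_kernel_absolutely_integrable] integral_product_kernel
    by (intro tendsto_mult tendsto_const) simp
  then show "((\<lambda>r. 1 / of_real pi * (exp (- of_real r * (a\<^sup>2 + b\<^sup>2)) * integral {0..} (\<lambda>t. exp (- of_real r * of_real t) * product_kernel a b t)))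
      \<longlongrightarrow> 1) (at_right 0)" by simp
qed (rule assms)

end

section \<open>Sector integrals\<close>

text \<open>With \<open>X = csqrt (a\<^sup>2 + t)\<close> the first factor of the denominator is
  \<open>X\<^sup>2 + b\<^sup>2\<close>; the acute angle between \<open>a\<close> and
  \<open>b\<close> persists between \<open>X\<close> and \<open>b\<close>, so it has no zero. A
  primitive is \<open>- (2 / b) * Arctan (b / X)\<close>.\<close>

lemma ray_kernel:
  fixes a b :: complex
  assumes a: "Re a > 0" and b: "Re b > 0" and ab: "Re (a * cnj b) > 0"
  defines "k \<equiv> \<lambda>t::real. 1 / ((of_real t + (a\<^sup>2 + b\<^sup>2)) * csqrt (a\<^sup>2 + of_real t))"
  shows "k absolutely_integrable_on {0..}" "integral {0..} k = 2 / b * Arctan (b / a)"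
    and "\<And>t. t \<ge> 0 \<Longrightarrow> of_real t + (a\<^sup>2 + b\<^sup>2) \<noteq> 0"
proof -
  let ?X = "\<lambda>t::real. csqrt (a\<^sup>2 + of_real t)"
  have a': "Re a > 0 \<or> a = 0" using a by simp
  have nz: "a \<noteq> 0" "b \<noteq> 0" using a b by auto
  have Xb: "Re (?X t * cnj b) > 0" if "t \<ge> 0" for t
    using Re_mult_csqrt_add[OF a', of t "cnj b"] nz a b ab that by (cases "t = 0") (auto simp: mult.commute)
  have ne: "of_real t + (a\<^sup>2 + b\<^sup>2) \<noteq> 0" if "t \<ge> 0" for t
    using sum_squares_nonzero[OF Xb[OF that], of 1] by (simp add: algebra_simps)
  show "of_real t + (a\<^sup>2 + b\<^sup>2) \<noteq> 0" if "t \<ge> 0" for t using ne that .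
  have X_nz: "?X t \<noteq> 0" if "t \<ge> 0" for t using Xb[OF that] by auto
  have lim1: "((\<lambda>t::real. 1 / (of_real t + (a\<^sup>2 + b\<^sup>2))) \<longlongrightarrow> 0) at_top"
    by (intro tendsto_divide_0[OF tendsto_const] tendsto_add_filterlim_at_infinity'[OF _ tendsto_const]
        filterlim_of_real_at_infinity)
  have lim2: "((\<lambda>t. b / ?X t) \<longlongrightarrow> 0) at_top"
  proof -
    have "((\<lambda>t. b * (of_real (sqrt t) / ?X t) * (1 / of_real (sqrt t))) \<longlongrightarrow> b * 1 * 0) at_top"
      by (intro tendsto_mult tendsto_const tendsto_div_csqrt_add_top tendsto_inverse_sqrt)
    moreover have "eventually (\<lambda>t. b * (of_real (sqrt t) / ?X t) * (1 / of_real (sqrt t)) = b / ?X t) at_top"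
      using eventually_gt_at_top[of 0] by eventually_elim simp
    ultimately show ?thesis by (simp add: Lim_transform_eventually)
  qed
  obtain l where l: "((\<lambda>t. of_real (sqrt t) / ?X t) \<longlongrightarrow> l) (at_right 0)"
    using tendsto_div_csqrt_add_0[OF a'] .
  show k: "k absolutely_integrable_on {0..}"
  proof (rule absolutely_integrable_halfline)
    show "continuous_on {0<..} k"
      unfolding k_def using ne X_nz by (intro continuous_intros continuous_on_csqrt_add a') auto
    have eq: "of_real (sqrt t * (1 + t)) * k t = of_real (sqrt t) / ?X t * (of_real (1 + t) / (of_real t + (a\<^sup>2 + b\<^sup>2)))" for t
      by (simp add: k_def)
    show "((\<lambda>t. of_real (sqrt t * (1 + t)) * k t) \<longlongrightarrow> l * (of_real (1 + 0) / (of_real 0 + (a\<^sup>2 + b\<^sup>2)))) (at_right 0)"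
      unfolding eq using ne[of 0] by (intro tendsto_intros l) auto
    \<comment> \<open>The quotient \<open>(1 + t) / (t + c)\<close> with
      \<open>c = a\<^sup>2 + b\<^sup>2\<close> is written as \<open>1 + (1 - c) / (t + c)\<close> to
      expose its limit 1.\<close>
    have "((\<lambda>t. of_real (sqrt t) / ?X t * (1 + (1 - (a\<^sup>2 + b\<^sup>2)) * (1 / (of_real t + (a\<^sup>2 + b\<^sup>2)))))
        \<longlongrightarrow> 1 * (1 + (1 - (a\<^sup>2 + b\<^sup>2)) * 0)) at_top"
      by (intro tendsto_intros tendsto_div_csqrt_add_top lim1)
    moreover have "eventually (\<lambda>t. of_real (sqrt t) / ?X t * (1 + (1 - (a\<^sup>2 + b\<^sup>2)) * (1 / (of_real t + (a\<^sup>2 + b\<^sup>2))))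
        = of_real (sqrt t * (1 + t)) * k t) at_top"
      using eventually_gt_at_top[of 0]
    proof eventually_elim
      case (elim t)
      have "1 + (1 - c) * (1 / s) = (1 + s - c) / s" if "s \<noteq> 0" for c s :: complex
        using that by (simp add: divide_simps)
      from this[OF ne[of t], of "a\<^sup>2 + b\<^sup>2"] show ?case unfolding eq using elim by simp
    qed
    ultimately show "((\<lambda>t. of_real (sqrt t * (1 + t)) * k t) \<longlongrightarrow> 1) at_top"
      by (simp add: Lim_transform_eventually)
  qed
  have Arctan_ok: "Re (b / ?X t) = 0 \<Longrightarrow> \<bar>Im (b / ?X t)\<bar> < 1" if "t \<ge> 0" for t
    using Re_divide_pos[OF Xb[OF that]] by simp
  have "(k has_integral - (2 / b) * Arctan 0 - - (2 / b) * Arctan (b / a)) {0..}"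
  proof (rule has_integral_FTC_halfline[OF k])
    fix t :: real assume t: "t > 0"
    have dX: "((\<lambda>z. csqrt (a\<^sup>2 + z)) has_field_derivative 1 / (2 * ?X t)) (at (of_real t))"
      using csqrt_add_pos(1)[OF a', of t] t by (auto intro!: derivative_eq_intros)
    have "(Arctan has_field_derivative inverse (1 + (b / ?X t)\<^sup>2)) (at (b / ?X t))"
      using Arctan_ok[of t] t by (intro has_field_derivative_Arctan) auto
    from DERIV_cmult[OF DERIV_chain2[OF this DERIV_divide[OF DERIV_const dX]], of "- (2 / b)"]
    have "((\<lambda>z. - (2 / b) * Arctan (b / csqrt (a\<^sup>2 + z))) has_field_derivative
        - (2 / b) * (inverse (1 + (b / ?X t)\<^sup>2) * ((0 * ?X t - b * (1 / (2 * ?X t))) / (?X t * ?X t)))) (at (of_real t))"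
      using X_nz[of t] t by simp
    moreover have "- (2 / b) * (inverse (1 + (b / ?X t)\<^sup>2) * ((0 * ?X t - b * (1 / (2 * ?X t))) / (?X t * ?X t))) = k t"
    proof -
      have *: "- (2 / b) * (inverse (1 + (b / x)\<^sup>2) * ((0 * x - b * (1 / (2 * x))) / (x * x))) = 1 / (s * x)"
        if "s = x\<^sup>2 + b\<^sup>2" "s \<noteq> 0" "x \<noteq> 0" for s x
      proof -
        have "1 + (b / x)\<^sup>2 = s / (x * x)" using that by (simp add: power2_eq_square divide_simps)
        then show ?thesis using that(2,3) nz by simp
      qed
      show ?thesis unfolding k_def by (rule *) (use ne[of t] X_nz[of t] t in auto)
    qed
    ultimately have "((\<lambda>z. - (2 / b) * Arctan (b / csqrt (a\<^sup>2 + z))) has_field_derivative k t) (at (of_real t))"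
      by simp
    from has_vector_derivative_real_field[OF this]
    show "((\<lambda>t. - (2 / b) * Arctan (b / ?X t)) has_vector_derivative k t) (at t)" .
  next
    have "isCont Arctan (b / a)"
      using Re_divide_pos[OF ab] by (intro continuous_at_Arctan) auto
    moreover have "((\<lambda>t. b / ?X t) \<longlongrightarrow> b / a) (at_right 0)"
      using nz by (intro tendsto_intros tendsto_csqrt_add_0 a')
    ultimately show "((\<lambda>t. - (2 / b) * Arctan (b / ?X t)) \<longlongrightarrow> - (2 / b) * Arctan (b / a)) (at_right 0)"
      by (intro tendsto_mult tendsto_const isCont_tendsto_compose[of _ Arctan])
    show "((\<lambda>t. - (2 / b) * Arctan (b / ?X t)) \<longlongrightarrow> - (2 / b) * Arctan 0) at_top"
      by (intro tendsto_mult tendsto_const isCont_tendsto_compose[OF continuous_at_Arctan] lim2) auto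
  qed
  then show "integral {0..} k = 2 / b * Arctan (b / a)" by (simp add: integral_unique)
qed

text \<open>For positive real \<open>a\<close>, \<open>b\<close> the left side is the mass of the
  strip \<open>x \<ge> a\<close>, \<open>0 \<le> y \<le> b\<close>: the sector piece
  \<open>x \<ge> a\<close> of slope at most \<open>b / a\<close>, minus its part above
  \<open>y = b\<close>. In general the \<open>p\<close>-derivatives agree and both sides tend to
  0.\<close>

lemma erf_mult_erfc:
  assumes a: "Re a > 0" and b: "Re b > 0" and ab: "Re (a * cnj b) > 0"
  shows "erf b * erfc a = 2 * a * b / of_real pi * sector_integral a b 1
    - b / of_real pi * (exp (- (a\<^sup>2 + b\<^sup>2)) *
        integral {0..} (\<lambda>t. exp (- of_real t) * (1 / ((of_real t + (a\<^sup>2 + b\<^sup>2)) * csqrt (a\<^sup>2 + of_real t)))))"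
proof -
  define k where "k t = 1 / ((of_real t + (a\<^sup>2 + b\<^sup>2)) * csqrt (a\<^sup>2 + of_real t))" for t :: real
  note ray = ray_kernel[OF a b ab, folded k_def]
  have nz: "a \<noteq> 0" "b \<noteq> 0" using a b by auto
  let ?s = "complex_of_real (sqrt pi)"
  have s: "complex_of_real pi = ?s * ?s" "?s \<noteq> 0" by (simp_all flip: of_real_mult)
  let ?f = "\<lambda>p. erf (b * csqrt p) * erfc (a * csqrt p)"
  let ?g = "\<lambda>p. 2 * a * b / of_real pi * sector_integral a b p
    - b / of_real pi * (exp (- p * (a\<^sup>2 + b\<^sup>2)) * integral {0..} (\<lambda>t. exp (- p * of_real t) * k t))"
  have "?f 1 = ?g 1"
  proof (rule complex_eq_on_half_plane[where f = ?f and g = ?g])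
    fix p :: complex assume p: "Re p > 0"
    have cp: "csqrt p \<noteq> 0" using p by auto
    let ?D = "b * exp (- p * b\<^sup>2) / (?s * csqrt p) * erfc (a * csqrt p) - a * exp (- p * a\<^sup>2) / (?s * csqrt p) * erf (b * csqrt p)"
    have D: "((\<lambda>p. erf (c * csqrt p)) has_field_derivative c * exp (- p * c\<^sup>2) / (?s * csqrt p)) (at p)" for c
      by (rule erf_mult_csqrt_has_field_derivative[OF p])
    have D': "((\<lambda>p. erfc (c * csqrt p)) has_field_derivative - (c * exp (- p * c\<^sup>2) / (?s * csqrt p))) (at p)" for c
      unfolding erfc_def using DERIV_diff[OF DERIV_const D[of c], of 1] by simp
    show "(?f has_field_derivative ?D) (at p)"
      using DERIV_mult'[OF D[of b] D'[of a]] by (simp add: algebra_simps)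
    have "integral {0..} (\<lambda>t. exp (- p * of_real t) * ((of_real t + (a\<^sup>2 + b\<^sup>2)) * k t))
        = integral {0..} (\<lambda>t. exp (- p * of_real t) * (1 / csqrt (a\<^sup>2 + of_real t)))"
      using ray(3) by (intro integral_cong) (simp add: k_def)
    also have "\<dots> = exp (p * a\<^sup>2) * ?s / csqrt p * erfc (a * csqrt p)"
      using a by (intro integral_unique has_integral_exp_div_csqrt p) auto
    finally have int: "integral {0..} (\<lambda>t. exp (- p * of_real t) * ((of_real t + (a\<^sup>2 + b\<^sup>2)) * k t)) = \<dots>" .
    have "(?g has_field_derivative
        2 * a * b / of_real pi * - (?s * exp (- p * a\<^sup>2) * erf (b * csqrt p) / (2 * b * csqrt p))
        - b / of_real pi * (- exp (- p * (a\<^sup>2 + b\<^sup>2)) * (exp (p * a\<^sup>2) * ?s / csqrt p * erfc (a * csqrt p)))) (at p)"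
      using DERIV_diff[OF DERIV_cmult[OF sector_integral_has_field_derivative_erf[OF ab p], of "2 * a * b / of_real pi"]
          DERIV_cmult[OF shifted_laplace_has_field_derivative[OF ray(1) p, of "a\<^sup>2 + b\<^sup>2"], of "b / of_real pi"]]
      unfolding int .
    moreover have "2 * a * b / of_real pi * - (?s * exp (- p * a\<^sup>2) * erf (b * csqrt p) / (2 * b * csqrt p))
        - b / of_real pi * (- exp (- p * (a\<^sup>2 + b\<^sup>2)) * (exp (p * a\<^sup>2) * ?s / csqrt p * erfc (a * csqrt p))) = ?D"
    proof -
      have e: "exp (- p * (a\<^sup>2 + b\<^sup>2)) = exp (- p * a\<^sup>2) * exp (- p * b\<^sup>2)"
        by (simp add: algebra_simps flip: exp_add)
      have u: "exp (- p * a\<^sup>2) * exp (p * a\<^sup>2) = 1"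
        by (simp flip: exp_add)
      have *: "2 * a * b / (s * s) * - (s * A * F / (2 * b * q)) - b / (s * s) * (- (A * B) * (A' * s / q * G))
          = b * B / (s * q) * G - a * A / (s * q) * F"
        if "A * A' = 1" "s \<noteq> 0" "q \<noteq> 0" for A B A' F G s q
      proof -
        have "2 * a * b / (s * s) * - (s * A * F / (2 * b * q)) - b / (s * s) * (- (A * B) * (A' * s / q * G))
            = b * B * (A * A') / (s * q) * G - a * A / (s * q) * F"
          using that(2,3) nz by (simp add: divide_simps)
        then show ?thesis using that by simp
      qed
      show ?thesis unfolding e s(1) by (rule *[OF u s(2) cp])
    qed
    ultimately show "(?g has_field_derivative ?D) (at p)" by metis
  next
    have "((\<lambda>r. ?f (of_real r)) \<longlongrightarrow> erf 0 * erfc 0) (at_right 0)"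
      by (intro tendsto_intros tendsto_erf tendsto_erfc tendsto_mult_csqrt_of_real_0)
    then show "((\<lambda>r. ?f (of_real r)) \<longlongrightarrow> 0) (at_right 0)" by simp
    \<comment> \<open>Both terms tend to \<open>2 / pi * Arctan (b / a)\<close> and cancel.\<close>
    have "((\<lambda>r. ?g (of_real r)) \<longlongrightarrow> 2 * a * b / of_real pi * (Arctan (b / a) / (a * b)) - b / of_real pi * integral {0..} k) (at_right 0)"
      by (intro tendsto_diff tendsto_mult tendsto_const sector_integral_tendsto[OF ab] shifted_laplace_tendsto[OF ray(1)])
    then show "((\<lambda>r. ?g (of_real r)) \<longlongrightarrow> 0) (at_right 0)"
      unfolding ray(2) using nz by simp
  qed simp
  then show ?thesis by (simp add: k_def)
qed

text \<open>Substitution \<open>t = (s * b)\<^sup>2\<close>: it carries the unit interval to the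
  segment, \<open>Re b > 0\<close> makes \<open>csqrt t\<close> equal to \<open>s * b\<close>, and
  the differential absorbs the singularity at the starting point.\<close>

lemma sector_integral_contour:
  assumes b: "Re b > 0" and ab: "Re (a * cnj b) > 0"
  shows "((\<lambda>t. exp (- t) / ((t + a\<^sup>2) * csqrt t)) has_contour_integral 2 * b * exp (a\<^sup>2) * sector_integral a b 1)
    (linepath 0 (b\<^sup>2))"
proof -
  define \<phi> where "\<phi> s = 2 * b * exp (a\<^sup>2) * (exp (- 1 * ((of_real s * b)\<^sup>2 + a\<^sup>2)) / ((of_real s * b)\<^sup>2 + a\<^sup>2))" for s :: real
  have nz: "b \<noteq> 0" using b by auto
  have "((\<lambda>s. (inverse (sqrt s) / 2) *\<^sub>R \<phi> (sqrt s)) has_integral integral {sqrt 0..sqrt 1} \<phi>) {0..1}"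
  \<comment> \<open>The exceptional set is \<open>{0}\<close> because \<open>sqrt\<close> is not
    differentiable there.\<close>
  proof (rule has_integral_substitution_strong[where s = "{0}" and c = 0 and d = 1])
    show "continuous_on {0..1} \<phi>"
      unfolding \<phi>_def by (intro continuous_intros sector_integrand_continuous ab)
    show "continuous_on {0..1} sqrt" by (intro continuous_intros)
    fix x :: real assume "x \<in> {0..1} - {0}"
    then show "(sqrt has_field_derivative inverse (sqrt x) / 2) (at x within {0..1})"
      by (auto intro!: has_field_derivative_at_within DERIV_real_sqrt)
  qed auto
  also have "integral {sqrt 0..sqrt 1} \<phi> = 2 * b * exp (a\<^sup>2) * sector_integral a b 1"
    unfolding sector_integral_def \<phi>_def real_sqrt_zero real_sqrt_one
    by (rule Henstock_Kurzweil_Integration.integral_mult_right)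
  finally have "((\<lambda>s. (inverse (sqrt s) / 2) *\<^sub>R \<phi> (sqrt s)) has_integral 2 * b * exp (a\<^sup>2) * sector_integral a b 1) {0..1}" .
  moreover have "exp (- linepath 0 (b\<^sup>2) s) / ((linepath 0 (b\<^sup>2) s + a\<^sup>2) * csqrt (linepath 0 (b\<^sup>2) s)) * (b\<^sup>2 - 0)
      = (inverse (sqrt s) / 2) *\<^sub>R \<phi> (sqrt s)" if s: "s \<in> {0..1} - {0}" for s
  proof -
    have "s > 0" using s by auto
    define r where "r = complex_of_real (sqrt s)"
    have r: "r \<noteq> 0" "r\<^sup>2 = of_real s" using \<open>s > 0\<close> by (simp_all add: r_def flip: of_real_power)
    have l: "linepath 0 (b\<^sup>2) s = (r * b)\<^sup>2"
      by (simp add: linepath_def scaleR_conv_of_real power_mult_distrib r)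
    have "csqrt ((r * b)\<^sup>2) = r * b"
      using b \<open>s > 0\<close> by (intro csqrt_square) (simp add: r_def)
    moreover have "exp (a\<^sup>2) * exp (- 1 * ((r * b)\<^sup>2 + a\<^sup>2)) = exp (- ((r * b)\<^sup>2))"
      unfolding exp_add[symmetric] by simp
    then have "\<phi> (sqrt s) = 2 * b * exp (- ((r * b)\<^sup>2)) / ((r * b)\<^sup>2 + a\<^sup>2)"
      unfolding \<phi>_def r_def[symmetric] by (simp add: mult.assoc)
    moreover have "(inverse (sqrt s) / 2) *\<^sub>R w = 1 / (2 * r) * w" for w :: complex
      by (simp add: scaleR_conv_of_real r_def inverse_eq_divide)
    ultimately show ?thesis
      unfolding l using nz r by (simp add: power2_eq_square)
  qed
  ultimately have "((\<lambda>s. exp (- linepath 0 (b\<^sup>2) s) / ((linepath 0 (b\<^sup>2) s + a\<^sup>2) * csqrt (linepath 0 (b\<^sup>2) s)) * (b\<^sup>2 - 0))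
      has_integral 2 * b * exp (a\<^sup>2) * sector_integral a b 1) {0..1}"
    by (rule has_integral_spike[OF negligible_sing[of 0], rotated])
  then show ?thesis unfolding has_contour_integral_linepath .
qed

section \<open>From angle conditions to the stated formulas\<close>

lemma Re_mult_pos_Arg:
  assumes "a \<noteq> 0" "b \<noteq> 0" "\<bar>Arg a + Arg b\<bar> < pi / 2"
  shows "Re (a * b) > 0"
proof -
  have "a * b = rcis (norm a * norm b) (Arg a + Arg b)"
    by (metis rcis_cmod_Arg rcis_mult)
  then have "Re (a * b) = norm a * norm b * cos (Arg a + Arg b)" by simp
  moreover have "cos (Arg a + Arg b) > 0" using assms(3) by (intro cos_gt_zero_pi; linarith)
  ultimately show ?thesis using assms by simp
qed

lemma Re_mult_cnj_pos_Arg: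
  assumes "Re a > 0" "Re b > 0" "\<bar>Arg a - Arg b\<bar> < pi / 2"
  shows "Re (a * cnj b) > 0"
proof -
  have "Arg (cnj b) = - Arg b" using assms(2) Arg_eq_0[of b] by (auto simp: Arg_cnj)
  then show ?thesis using assms by (intro Re_mult_pos_Arg) auto
qed

text \<open>The principal root halves the argument, which then lies strictly between
  \<open>- pi / 2\<close> and \<open>pi / 2\<close>.\<close>

lemma Re_csqrt_pos_Arg:
  assumes "\<bar>Arg x\<bar> < pi"
  shows "Re (csqrt x) > 0 \<or> csqrt x = 0"
  using Re_mult_pos_Arg[of "csqrt x" 1] assms by auto

text \<open>The quotient with the apparent pole and the regular kernel differ on the half line in at
  most two points, a null set.\<close>

lemma (in erfc_pair) erfc_product_integrand:
  fixes f :: "real \<Rightarrow> complex"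
  assumes p: "Re p > 0"
    and f: "\<And>t. f t = exp (- p * of_real t) *
      ((a * X t + b * Y t) / ((a\<^sup>2 + b\<^sup>2 + of_real t) * csqrt ((a\<^sup>2 + of_real t) * (b\<^sup>2 + of_real t))))"
  shows "f absolutely_integrable_on {0..}"
    and "erfc (a * csqrt p) * erfc (b * csqrt p) =
      1 / of_real pi * exp (- p * (a\<^sup>2 + b\<^sup>2)) * integral {0..} f"
proof -
  \<comment> \<open>A zero of \<open>a\<^sup>2 + b\<^sup>2 + t\<close> at real \<open>t\<close> can
    only be \<open>- Re (a\<^sup>2 + b\<^sup>2)\<close>; the point 0 is listed because the kernel
    identities are stated for \<open>t > 0\<close>.\<close>
  define N where "N = {0, - Re (a\<^sup>2 + b\<^sup>2)}"
  have N: "negligible N" by (simp add: N_def)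
  have eq: "f t = exp (- p * of_real t) * product_kernel a b t" if "t \<in> {0..} - N" for t
  proof -
    have "t > 0" "Re (a\<^sup>2 + b\<^sup>2 + of_real t) \<noteq> 0" using that by (auto simp: N_def)
    then have "a\<^sup>2 + b\<^sup>2 + of_real t \<noteq> 0" by (metis zero_complex.sel(1))
    from integrand_eq_product_kernel[OF \<open>t > 0\<close> this] show ?thesis by (simp only: f)
  qed
  have "(\<lambda>t. exp (- p * of_real t) * product_kernel a b t) absolutely_integrable_on {0..}"
    using p by (intro laplace_absolutely_integrable product_kernel_absolutely_integrable) simp
  then show "f absolutely_integrable_on {0..}"
    by (rule absolutely_integrable_spike[OF _ N eq])
  have "integral {0..} f = integral {0..} (\<lambda>t. exp (- p * of_real t) * product_kernel a b t)"
    by (rule integral_spike[OF N]) (simp only: eq)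
  then show "erfc (a * csqrt p) * erfc (b * csqrt p) =
      1 / of_real pi * exp (- p * (a\<^sup>2 + b\<^sup>2)) * integral {0..} f"
    using erfc_product[OF p] by (simp add: mult.assoc)
qed

text \<open>This is the degenerate pair of 0 and \<open>b\<close>: one factor is
  \<open>erfc 0 = 1\<close>, and after the root of the product is split, \<open>Y t\<close> cancels
  from the integrand.\<close>

lemma erfc_integral:
  fixes b :: complex
  assumes b: "Re b > 0"
  defines "f \<equiv> \<lambda>t::real. exp (- of_real t) / ((of_real t + b\<^sup>2) * csqrt (of_real t))"
  shows "f absolutely_integrable_on {0..}"
    and "erfc b = b / of_real pi * exp (- (b\<^sup>2)) * integral {0..} f"
proof -
  have nz: "b \<noteq> 0" using b by auto
  interpret erfc_pair 0 b by (rule erfc_pair.intro) (use b nz in auto)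
  let ?g = "\<lambda>t::real. exp (- 1 * of_real t) * ((0 * csqrt (0\<^sup>2 + of_real t) + b * csqrt (b\<^sup>2 + of_real t)) /
    ((0\<^sup>2 + b\<^sup>2 + of_real t) * csqrt ((0\<^sup>2 + of_real t) * (b\<^sup>2 + of_real t))))"
  have g: "?g absolutely_integrable_on {0..}" "erfc b = 1 / of_real pi * exp (- (b\<^sup>2)) * integral {0..} ?g"
    using erfc_product_integrand[of 1 ?g] by simp_all
  have eq: "f t = 1 / b * ?g t" if "t \<in> {0..} - {0}" for t
  proof -
    have "t > 0" using that by auto
    have "?g t = exp (- of_real t) * (b * Y t / ((b\<^sup>2 + of_real t) * (csqrt (of_real t) * Y t)))"
      using csqrt_mult_shifted[OF \<open>t > 0\<close>] by simp
    then show ?thesis unfolding f_def using Y_nz[OF \<open>t > 0\<close>] nz by (simp add: add.commute)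
  qed
  have "(\<lambda>t. 1 / b * ?g t) absolutely_integrable_on {0..}"
    by (rule set_integrable_mult_right[OF g(1)])
  then show "f absolutely_integrable_on {0..}"
    by (rule absolutely_integrable_spike[OF _ negligible_sing[of 0] eq])
  have "integral {0..} f = integral {0..} (\<lambda>t. 1 / b * ?g t)"
    by (rule integral_spike[OF negligible_sing[of 0]]) (simp only: eq)
  then have int: "integral {0..} f = 1 / b * integral {0..} ?g"
    by (simp only: Henstock_Kurzweil_Integration.integral_mult_right)
  have "b * (1 / b * w) = w" for w using nz by simp
  from this[of "integral {0..} ?g"] have "integral {0..} ?g = b * integral {0..} f" unfolding int by (rule sym)
  then show "erfc b = b / of_real pi * exp (- (b\<^sup>2)) * integral {0..} f" unfolding g(2) by simp
qed

text \<open>The decomposition is \<open>1 - erf a * erf b = erfc b + erf b * erfc a\<close>: the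
  complement of a rectangle is the region above it together with the strip to its right. The ray
  integral joins the integral for \<open>erfc b\<close>, and the sector integral becomes the contour
  integral.\<close>

lemma one_minus_erf_product:
  fixes a b :: complex
  assumes a: "Re a > 0" and b: "Re b > 0" and ab: "Re (a * cnj b) > 0"
  defines "f \<equiv> \<lambda>t::real. exp (- of_real t) * (1 / ((of_real t + b\<^sup>2) * csqrt (of_real t))
      - exp (- (a\<^sup>2)) / ((of_real t + a\<^sup>2 + b\<^sup>2) * csqrt (of_real t + a\<^sup>2)))"
    and "g \<equiv> \<lambda>t. exp (- t) / ((t + a\<^sup>2) * csqrt t)"
  shows "f absolutely_integrable_on {0..}"
    and "1 - erf a * erf b = b / of_real pi * exp (- (b\<^sup>2)) * integral {0..} f
      + a / of_real pi * exp (- (a\<^sup>2)) * contour_integral (linepath 0 (b\<^sup>2)) g"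
proof -
  define h where "h t = exp (- of_real t) / ((of_real t + b\<^sup>2) * csqrt (of_real t))" for t :: real
  define k where "k t = exp (- of_real t) * (1 / ((of_real t + (a\<^sup>2 + b\<^sup>2)) * csqrt (a\<^sup>2 + of_real t)))" for t :: real
  note h = erfc_integral[OF b, folded h_def]
  have k: "k absolutely_integrable_on {0..}"
    using laplace_absolutely_integrable[OF ray_kernel(1)[OF a b ab], of 1]
    by (simp add: k_def[abs_def])
  then have k': "(\<lambda>t. exp (- (a\<^sup>2)) * k t) absolutely_integrable_on {0..}"
    by (rule set_integrable_mult_right)
  have f: "f = (\<lambda>t. h t - exp (- (a\<^sup>2)) * k t)"
    by (simp add: f_def h_def k_def algebra_simps fun_eq_iff)
  show "f absolutely_integrable_on {0..}" unfolding f by (rule set_integral_diff(1)[OF h(1) k'])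
  have int: "integral {0..} f = integral {0..} h - exp (- (a\<^sup>2)) * integral {0..} k"
    unfolding f using h(1) k k'
    by (subst integral_diff) (auto simp: absolutely_integrable_on_def)
  have exp_sum: "exp (- (a\<^sup>2 + b\<^sup>2)) = exp (- (a\<^sup>2)) * exp (- (b\<^sup>2))"
    by (simp flip: exp_add)
  have first: "b / of_real pi * exp (- (b\<^sup>2)) * integral {0..} f
      = erfc b - b / of_real pi * (exp (- (a\<^sup>2 + b\<^sup>2)) * integral {0..} k)"
    unfolding int h(2) exp_sum by (simp add: algebra_simps)
  have "contour_integral (linepath 0 (b\<^sup>2)) g = 2 * b * exp (a\<^sup>2) * sector_integral a b 1"
    unfolding g_def by (rule contour_integral_unique[OF sector_integral_contour[OF b ab]])
  then have contour: "a / of_real pi * exp (- (a\<^sup>2)) * contour_integral (linepath 0 (b\<^sup>2)) g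
      = 2 * a * b / of_real pi * sector_integral a b 1"
    by (simp add: exp_minus)
  have erf_erfc: "erf b * erfc a = 2 * a * b / of_real pi * sector_integral a b 1
      - b / of_real pi * (exp (- (a\<^sup>2 + b\<^sup>2)) * integral {0..} k)"
    using erf_mult_erfc[OF a b ab] by (simp only: k_def[abs_def])
  have split: "1 - erf a * erf b = erfc b + erf b * erfc a"
    by (simp add: erfc_def algebra_simps)
  show "1 - erf a * erf b = b / of_real pi * exp (- (b\<^sup>2)) * integral {0..} f
      + a / of_real pi * exp (- (a\<^sup>2)) * contour_integral (linepath 0 (b\<^sup>2)) g"
    unfolding split erf_erfc first contour by (simp only: diff_conv_add_uminus add_ac)
qed

theorem corollary3p6p1:
  shows
    "(\<forall>p x y :: complex.
        Re p > 0 \<longrightarrow> \<bar>Arg y\<bar> < pi \<longrightarrow> \<bar>Arg x\<bar> < pi \<longrightarrow> \<bar>Arg x + Arg y\<bar> < pi \<longrightarrow>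
        \<not> (x = 0 \<and> y = 0) \<longrightarrow>
        (let f = (\<lambda>t::real. exp (- p * of_real t) *
                   ((csqrt x * csqrt (x + of_real t) + csqrt y * csqrt (y + of_real t)) /
                    ((x + y + of_real t) * csqrt ((x + of_real t) * (y + of_real t)))))
         in f absolutely_integrable_on {0..} \<and>
            exp (p * (x + y)) * erfc (csqrt y * csqrt p) * erfc (csqrt x * csqrt p)
              = 1 / of_real pi * integral {0..} f))
   \<and> (\<forall>a b :: complex.
        (Re a > 0 \<or> a = 0) \<longrightarrow> (Re b > 0 \<or> b = 0) \<longrightarrow> \<not> (a = 0 \<and> b = 0) \<longrightarrow>
        \<bar>Arg a + Arg b\<bar> < pi / 2 \<longrightarrow>
        (let f = (\<lambda>t::real. exp (- of_real t) *
                   ((a * csqrt (of_real t + a ^ 2) + b * csqrt (of_real t + b ^ 2)) /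
                    ((of_real t + a ^ 2 + b ^ 2) *
                      csqrt ((of_real t + a ^ 2) * (of_real t + b ^ 2)))))
         in f absolutely_integrable_on {0..} \<and>
            erfc a * erfc b
              = 1 / of_real pi * exp (- (a ^ 2 + b ^ 2)) * integral {0..} f))
   \<and> (\<forall>b :: complex.
        Re b > 0 \<longrightarrow>
        (let f = (\<lambda>t::real. exp (- of_real t) / ((of_real t + b ^ 2) * csqrt (of_real t)))
         in f absolutely_integrable_on {0..} \<and>
            erfc b = b / of_real pi * exp (- (b ^ 2)) * integral {0..} f \<and>
            erf b = 1 - b / of_real pi * exp (- (b ^ 2)) * integral {0..} f))
   \<and> (\<forall>a b :: complex.
        Re a > 0 \<longrightarrow> Re b > 0 \<longrightarrow> \<bar>Arg a - Arg b\<bar> < pi / 2 \<longrightarrow>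
        (let f = (\<lambda>t::real. exp (- of_real t) *
                   (1 / ((of_real t + b ^ 2) * csqrt (of_real t))
                    - exp (- (a ^ 2)) /
                        ((of_real t + a ^ 2 + b ^ 2) * csqrt (of_real t + a ^ 2))));
             g = (\<lambda>t::complex. exp (- t) / ((t + a ^ 2) * csqrt t))
         in f absolutely_integrable_on {0..} \<and>
            g contour_integrable_on linepath 0 (b ^ 2) \<and>
            1 - erf a * erf b
              = b / of_real pi * exp (- (b ^ 2)) * integral {0..} f
                + a / of_real pi * exp (- (a ^ 2)) * contour_integral (linepath 0 (b ^ 2)) g))
   \<and> (\<forall>a :: complex.
        Re a > 0 \<longrightarrow>
        (let g = (\<lambda>t::complex. exp (- t) / ((t + a ^ 2) * csqrt t));
             h = (\<lambda>s::real. exp (- (a ^ 2) * of_real s ^ 2) / (of_real s ^ 2 + 1))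
         in g contour_integrable_on linepath 0 (a ^ 2) \<and>
            1 - erf a ^ 2
              = 2 * a / of_real pi * exp (- (a ^ 2)) * contour_integral (linepath 0 (a ^ 2)) g \<and>
            h absolutely_integrable_on {0..1} \<and>
            1 - erf a ^ 2
              = 4 / of_real pi * exp (- (a ^ 2)) * integral {0..1} h))"
proof (intro conjI allI impI)
  fix p x y :: complex
  assume p: "Re p > 0" and args: "\<bar>Arg y\<bar> < pi" "\<bar>Arg x\<bar> < pi" "\<bar>Arg x + Arg y\<bar> < pi"
    and nz: "\<not> (x = 0 \<and> y = 0)"
  \<comment> \<open>The roots halve all angles, so the bound \<open>pi\<close> on the sum of the
    arguments becomes the bound \<open>pi / 2\<close> for the pair.\<close>
  interpret erfc_pair "csqrt x" "csqrt y"
  proof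
    show "Re (csqrt x) > 0 \<or> csqrt x = 0" "Re (csqrt y) > 0 \<or> csqrt y = 0"
      by (intro Re_csqrt_pos_Arg args)+
    show "Re (csqrt x * csqrt y) > 0 \<or> csqrt x = 0 \<or> csqrt y = 0"
      using Re_mult_pos_Arg[of "csqrt x" "csqrt y"] args(3) by (auto simp flip: add_divide_distrib)
    show "csqrt x \<noteq> 0 \<or> csqrt y \<noteq> 0" using nz by auto
  qed
  let ?f = "\<lambda>t::real. exp (- p * of_real t) *
      ((csqrt x * csqrt (x + of_real t) + csqrt y * csqrt (y + of_real t)) /
       ((x + y + of_real t) * csqrt ((x + of_real t) * (y + of_real t))))"
  note main = erfc_product_integrand[OF p, of ?f, unfolded power2_csqrt, OF refl]
  let ?E = "exp (p * (x + y))" and ?E' = "exp (- p * (x + y))"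
  have E: "?E * ?E' = 1" by (simp flip: exp_add)
  have "?E * erfc (csqrt y * csqrt p) * erfc (csqrt x * csqrt p) = ?E * (erfc (csqrt x * csqrt p) * erfc (csqrt y * csqrt p))"
    by (simp only: mult_ac)
  also have "\<dots> = (?E * ?E') * (1 / of_real pi * integral {0..} ?f)"
    unfolding main(2) by (simp only: mult_ac)
  finally have "?E * erfc (csqrt y * csqrt p) * erfc (csqrt x * csqrt p) = 1 / of_real pi * integral {0..} ?f"
    by (simp only: E mult_1)
  with main(1) show "let f = ?f in f absolutely_integrable_on {0..} \<and>
      exp (p * (x + y)) * erfc (csqrt y * csqrt p) * erfc (csqrt x * csqrt p) = 1 / of_real pi * integral {0..} f"
    unfolding Let_def by (rule conjI)
next
  fix a b :: complex
  assume a: "Re a > 0 \<or> a = 0" and b: "Re b > 0 \<or> b = 0" and nz: "\<not> (a = 0 \<and> b = 0)"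
    and args: "\<bar>Arg a + Arg b\<bar> < pi / 2"
  interpret erfc_pair a b
    using a b nz Re_mult_pos_Arg[OF _ _ args] by unfold_locales auto
  let ?f = "\<lambda>t::real. exp (- of_real t) *
      ((a * csqrt (of_real t + a ^ 2) + b * csqrt (of_real t + b ^ 2)) /
       ((of_real t + a ^ 2 + b ^ 2) * csqrt ((of_real t + a ^ 2) * (of_real t + b ^ 2))))"
  have "?f t = exp (- 1 * of_real t) * ((a * csqrt (a\<^sup>2 + of_real t) + b * csqrt (b\<^sup>2 + of_real t)) /
      ((a\<^sup>2 + b\<^sup>2 + of_real t) * csqrt ((a\<^sup>2 + of_real t) * (b\<^sup>2 + of_real t))))" for t
    by (simp add: add_ac)
  from erfc_product_integrand[of 1 ?f, OF _ this]
  show "let f = ?f in f absolutely_integrable_on {0..} \<and>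
      erfc a * erfc b = 1 / of_real pi * exp (- (a ^ 2 + b ^ 2)) * integral {0..} f"
    unfolding Let_def by simp
next
  fix b :: complex
  assume b: "Re b > 0"
  show "let f = (\<lambda>t::real. exp (- of_real t) / ((of_real t + b ^ 2) * csqrt (of_real t)))
      in f absolutely_integrable_on {0..} \<and>
         erfc b = b / of_real pi * exp (- (b ^ 2)) * integral {0..} f \<and>
         erf b = 1 - b / of_real pi * exp (- (b ^ 2)) * integral {0..} f"
    unfolding Let_def erfc_integral(2)[OF b, symmetric]
    using erfc_integral(1)[OF b] by (simp add: erfc_def)
next
  fix a b :: complex
  assume a: "Re a > 0" and b: "Re b > 0" and args: "\<bar>Arg a - Arg b\<bar> < pi / 2"
  note ab = Re_mult_cnj_pos_Arg[OF a b args]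
  show "let f = (\<lambda>t::real. exp (- of_real t) *
                 (1 / ((of_real t + b ^ 2) * csqrt (of_real t))
                  - exp (- (a ^ 2)) /
                      ((of_real t + a ^ 2 + b ^ 2) * csqrt (of_real t + a ^ 2))));
            g = (\<lambda>t::complex. exp (- t) / ((t + a ^ 2) * csqrt t))
        in f absolutely_integrable_on {0..} \<and>
           g contour_integrable_on linepath 0 (b ^ 2) \<and>
           1 - erf a * erf b
             = b / of_real pi * exp (- (b ^ 2)) * integral {0..} f
               + a / of_real pi * exp (- (a ^ 2)) * contour_integral (linepath 0 (b ^ 2)) g"
    unfolding Let_def
    by (intro conjI one_minus_erf_product[OF a b ab]
        has_contour_integral_integrable[OF sector_integral_contour[OF b ab]])
next
  fix a :: complex
  assume a: "Re a > 0"
  \<comment> \<open>With equal arguments the acute-angle condition is automatic,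
    \<open>a * cnj a\<close> being a positive real.\<close>
  then have aa: "Re (a * cnj a) > 0" by (auto simp: add_pos_nonneg)
  \<comment> \<open>The contour form is read off from the sector identity; specialising the product
    formula would leave a half-line integral to be moved by the complex shift
    \<open>a\<^sup>2\<close>.\<close>
  have "1 - (erf a)\<^sup>2 = 2 * a / of_real pi * exp (- (a\<^sup>2)) *
      contour_integral (linepath 0 (a\<^sup>2)) (\<lambda>t. exp (- t) / ((t + a\<^sup>2) * csqrt t))"
    unfolding contour_integral_unique[OF sector_integral_contour[OF a aa]] one_minus_erf_squared_sector[OF a]
    by (simp add: exp_minus power2_eq_square)
  then show "let g = (\<lambda>t::complex. exp (- t) / ((t + a ^ 2) * csqrt t));
          h = (\<lambda>s::real. exp (- (a ^ 2) * of_real s ^ 2) / (of_real s ^ 2 + 1))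
      in g contour_integrable_on linepath 0 (a ^ 2) \<and>
         1 - erf a ^ 2
           = 2 * a / of_real pi * exp (- (a ^ 2)) * contour_integral (linepath 0 (a ^ 2)) g \<and>
         h absolutely_integrable_on {0..1} \<and>
         1 - erf a ^ 2
           = 4 / of_real pi * exp (- (a ^ 2)) * integral {0..1} h"
    unfolding Let_def
    by (intro conjI one_minus_erf_squared[OF a] has_contour_integral_integrable[OF sector_integral_contour[OF a aa]])
qed

end
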